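(* Assume the following. (1) For $\mu$-a.e. $s\in E$, the operator $A(s,\cdot)$ is maximal monotone; and for every $\lambda>0$ and $x\in\mathcal H$, the map $s\mapsto J_\lambda(s,x)$ is $\mathcal E/\mathcal B(\mathcal H)$-measurable. (2) $(\lambda_n)_{n\in\mathbb N}$ is a sequence of positive reals with $\sum_n\lambda_n=+\infty$ and $\sum_n\lambda_n^2<\infty$; the random variables $(\xi_n)_{n\ge1}$ are independent and identically distributed with distribution $\mu$. Suppose $\mathcal Z_A(2)\neq\emptyset$. Let $x_0\in\mathcal H$ be fixed and let $(x_n)$ be defined by $x_{n+1}=J_{\lambda_n}(\xi_{n+1},x_n)$, $n\in\mathbb N$. Then: (i) There exists an event $B\in\mathcal F$ with $\mathbb P(B)=1$ such that for every $\omega\in B$ and every $x^\star\in\mathcal Z_A(2)$, the sequence $(\|x_n(\omega)-x^\star\|)$ converges as $n\to\infty$. (ii) $\mathbb E\left(\sum_n\lambda_n^2\int\|A_{\lambda_n}(s,x_n)\|^2\,d\mu(s)\right)<\infty$. (iii) For every integer $p\ge1$ such that $\mathcal Z_A(2p)\ne\emptyset$, $\sup_n\mathbb E(\|x_n\|^{2p})<\infty$.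
   Context: $(E,\mathcal E,\mu)$ is a complete probability space, $\mathcal H$ is a separable Hilbert space with Borel $\sigma$-algebra $\mathcal B(\mathcal H)$, $A:E\times\mathcal H\to2^{\mathcal H}$ is a set-valued mapping, $(\Omega,\mathcal F,\mathbb P)$ is a probability space with expectation $\mathbb E$, and $\xi_n:\Omega\to E$ ($n\ge1$) are random variables. For $\lambda>0$, $J_\lambda(s,x)=(I+\lambda A(s,\cdot))^{-1}(x)$ is the resolvent and $A_\lambda(s,x)=(x-J_\lambda(s,x))/\lambda$ the Yosida approximation (both single-valued and defined on all of $\mathcal H$ whenever $A(s,\cdot)$ is maximal monotone). For $x\in\mathcal H$ and $p\ge1$, $S_A^p(x)$ is the set of measurable functions $\phi:E\to\mathcal H$ with $\phi(s)\in A(s,x)$ for $\mu$-a.e. $s$ and $\int\|\phi\|^p d\mu<\infty$, and $\mathcal Z_A(p)=\{x\in\mathcal H:\exists\phi\in S_A^p(x),\ \int\phi\,d\mu=0\}$ (Bochner integral). *)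

theory Defs
  imports "HOL-Probability.Probability"
begin

definition monotone_operator :: "('h::real_inner \<Rightarrow> 'h set) \<Rightarrow> bool" where
  "monotone_operator T \<longleftrightarrow>
     (\<forall>x y. \<forall>u\<in>T x. \<forall>v\<in>T y. 0 \<le> (x - y) \<bullet> (u - v))"

definition maximal_monotone :: "('h::real_inner \<Rightarrow> 'h set) \<Rightarrow> bool" where
  "maximal_monotone T \<longleftrightarrow> monotone_operator T \<and>
     (\<forall>S. monotone_operator S \<and> (\<forall>x. T x \<subseteq> S x) \<longrightarrow> S = T)"

text \<open>
  The resolvent is the unique element of the set \<open>(I + l T)\<^sup>-\<^sup>1 x\<close>.
  Its value is unspecified when that set is not a singleton; for maximal monotone
  \<open>T\<close> and \<open>l > 0\<close> this never happens (Minty).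
\<close>

definition resolvent :: "real \<Rightarrow> ('h::real_inner \<Rightarrow> 'h set) \<Rightarrow> 'h \<Rightarrow> 'h" where
  "resolvent l T x = the_elem {y. \<exists>u\<in>T y. x = y + l *\<^sub>R u}"

definition yosida :: "real \<Rightarrow> ('h::real_inner \<Rightarrow> 'h set) \<Rightarrow> 'h \<Rightarrow> 'h" where
  "yosida l T x = (x - resolvent l T x) /\<^sub>R l"

definition Lp_selections ::
  "'e measure \<Rightarrow> ('e \<Rightarrow> 'h::{real_inner, banach, second_countable_topology} \<Rightarrow> 'h set)
     \<Rightarrow> real \<Rightarrow> 'h \<Rightarrow> ('e \<Rightarrow> 'h) set" where
  "Lp_selections M A p x = {\<phi> \<in> borel_measurable M.
     (AE s in M. \<phi> s \<in> A s x) \<and> (\<integral>\<^sup>+ s. ennreal (norm (\<phi> s) powr p) \<partial>M) < \<infinity>}"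

text \<open>
  For \<open>p \<ge> 1\<close> and a finite measure, every element of \<^const>\<open>Lp_selections\<close> is Bochner
  integrable, so the convention that non-integrable functions have integral \<open>0\<close> plays no role.
\<close>

definition mean_zeros ::
  "'e measure \<Rightarrow> ('e \<Rightarrow> 'h::{real_inner, banach, second_countable_topology} \<Rightarrow> 'h set)
     \<Rightarrow> real \<Rightarrow> 'h set" where
  "mean_zeros M A p = {x. \<exists>\<phi>\<in>Lp_selections M A p x. (\<integral>s. \<phi> s \<partial>M) = 0}"

end

theory Submission
  imports Defs
begin

text \<open>
  Fix a mean zero \<open>z\<close> with a centred selection \<open>\<phi> s \<in> A s z\<close>. Monotonicity of \<open>A s\<close> between the
  points \<open>z\<close> and \<open>J y\<close>, where \<open>J\<close> is the resolvent with step \<open>l\<close>, gives for every \<open>y\<close> the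
  pathwise estimate (lemma \<open>resolvent_energy_decrease\<close>)
  \<open>|J y - z|\<^sup>2 + |y - J y|\<^sup>2 / 2 \<le> |y - z|\<^sup>2 - 2 l (\<phi> s \<bullet> (y - z)) + 2 l\<^sup>2 |\<phi> s|\<^sup>2\<close>.
  Along the random iteration the sample is independent of the current iterate and \<open>\<phi>\<close> has mean
  zero, so the cross term is a martingale difference, while the last term has a summable expectation
  because the squared steps are summable. Everything follows from this inequality.

  Raising it to the power \<open>p\<close> and expanding to second order, the first-order cross term still has
  mean zero and the rest is of order \<open>l\<^sup>2\<close> times the sum of the powers with exponent \<open>2 p\<close> of
  \<open>|y - z|\<close> and \<open>|\<phi> s|\<close> (lemma \<open>perturbed_power_step\<close>); a discrete Gronwall argument bounds the moments. Summing the expectations bounds the total of the expected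
  squared displacements \<open>|y - J y|\<^sup>2\<close>, which are \<open>l\<^sup>2\<close> times the squared Yosida approximations. For
  the almost sure convergence, the cross terms form a square-integrable martingale difference
  sequence with summable variances (the iterates are bounded in mean square), so their series
  converges almost surely, by Kolmogorov's maximal inequality. Hence the squared distances to \<open>z\<close>
  are decreasing up to the partial sums of two convergent series, and converge. Each \<open>z\<close> has its own
  exceptional null set; a countable dense set of mean zeros yields a common one, because the distance
  to \<open>z\<close> depends on \<open>z\<close> uniformly in the iterate.

  Two foundations are needed. The resolvent of a maximal monotone operator must be defined everywhere
  (Minty's theorem, \<open>minty\<close>), which is obtained by minimising the Fitzpatrick function plus half the
  squared norm; strong convexity makes minimising sequences Cauchy, so completeness suffices. And the
  resolvent must be jointly measurable in sample and point: it is measurable in one variable and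
  nonexpansive in the other (\<open>borel_measurable_Caratheodory\<close>).
\<close>

section \<open>Minty's theorem and the resolvent\<close>

lemma maximal_monotone_monotone:
  assumes "maximal_monotone T" "u \<in> T y" "v \<in> T z"
  shows "0 \<le> (y - z) \<bullet> (u - v)"
  using assms unfolding maximal_monotone_def monotone_operator_def by blast

text \<open>
  Otherwise adding the pair \<open>(a, b)\<close> to the graph would give a strictly larger monotone operator.
\<close>

lemma maximal_monotone_mem:
  assumes T: "maximal_monotone T"
    and rel: "\<And>y v. v \<in> T y \<Longrightarrow> 0 \<le> (a - y) \<bullet> (b - v)"
  shows "b \<in> T a"
proof -
  define S where "S = T(a := insert b (T a))"
  have rel': "0 \<le> (y - a) \<bullet> (v - b)" if "v \<in> T y" for y v
    using rel[OF that] by (metis inner_minus_left inner_minus_right minus_diff_eq minus_minus)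
  have "monotone_operator S"
    unfolding monotone_operator_def S_def
    using maximal_monotone_monotone[OF T] rel rel' by (auto split: if_splits)
  moreover have "\<forall>x. T x \<subseteq> S x" by (auto simp: S_def)
  ultimately have "S = T" using T unfolding maximal_monotone_def by blast
  thus ?thesis by (metis S_def fun_upd_same insertI1)
qed

text \<open>
  The set plays the role of the epigraph of a convex function \<open>g\<close>, and the conclusion is the
  first-order optimality condition for \<open>g + |\<cdot>|\<^sup>2 / 2\<close> at its minimiser. Working with the epigraph
  avoids extended-real values. Weak compactness is avoided as well: the quadratic term makes
  minimising sequences Cauchy.
\<close>

lemma strongly_convex_minimum:
  fixes C :: "('a::{real_inner, complete_space} \<times> real) set"
  assumes ne: "C \<noteq> {}" and cl: "closed C" and cv: "convex C"
    and nonneg: "\<And>w r. (w, r) \<in> C \<Longrightarrow> 0 \<le> r + (norm w)\<^sup>2 / 2"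
  obtains w r where "(w, r) \<in> C" "\<And>w' r'. (w', r') \<in> C \<Longrightarrow> r \<le> r' + w \<bullet> (w' - w)"
proof -
  define J where "J c = snd c + (norm (fst c))\<^sup>2 / 2" for c :: "'a \<times> real"
  define m where "m = Inf (J ` C)"
  have bdd: "bdd_below (J ` C)"
    by (rule bdd_belowI[of _ 0]) (use nonneg in \<open>auto simp: J_def\<close>)
  have m_le: "m \<le> J c" if "c \<in> C" for c
    unfolding m_def using bdd that by (simp add: cINF_lower)
  have "\<exists>c\<in>C. J c < m + 1 / real (Suc n)" for n
  proof -
    have "Inf (J ` C) < m + 1 / real (Suc n)" by (simp add: m_def)
    thus ?thesis using ne bdd by (subst (asm) cInf_less_iff) auto
  qed
  then obtain c where cC: "\<And>n. c n \<in> C" and cm: "\<And>n. J (c n) < m + 1 / real (Suc n)"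
    by metis
  \<comment> \<open>The parallelogram law bounds the distance of two near-minimisers by their excess over
    the infimum, because their midpoint is still in the set.\<close>
  have close: "(norm (fst (c i) - fst (c j)))\<^sup>2 \<le> 4 * (1 / real (Suc i)) + 4 * (1 / real (Suc j))" for i j
  proof -
    have "(1/2) *\<^sub>R c i + (1/2) *\<^sub>R c j \<in> C"
      using cv cC by (auto intro!: convexD)
    from m_le[OF this]
    have "m \<le> snd (c i) / 2 + snd (c j) / 2
        + (norm ((1/2) *\<^sub>R fst (c i) + (1/2) *\<^sub>R fst (c j)))\<^sup>2 / 2"
      by (simp add: J_def)
    moreover have "(norm ((1/2) *\<^sub>R fst (c i) + (1/2) *\<^sub>R fst (c j)))\<^sup>2
        = (norm (fst (c i)))\<^sup>2 / 2 + (norm (fst (c j)))\<^sup>2 / 2 - (norm (fst (c i) - fst (c j)))\<^sup>2 / 4"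
      by (simp add: power2_norm_eq_inner inner_add inner_diff inner_commute field_simps)
    ultimately have "m \<le> J (c i) / 2 + J (c j) / 2 - (norm (fst (c i) - fst (c j)))\<^sup>2 / 8"
      by (simp only: J_def) (simp add: field_simps)
    with cm[of i] cm[of j] show ?thesis by linarith
  qed
  have "Cauchy (\<lambda>n. fst (c n))"
  proof (rule metric_CauchyI)
    fix e :: real assume "0 < e"
    then obtain N where N: "1 / real (Suc N) < e\<^sup>2 / 8"
      using nat_approx_posE[of "e\<^sup>2 / 8"] by auto
    have "dist (fst (c i)) (fst (c j)) < e" if "N \<le> i" "N \<le> j" for i j
    proof -
      have "1 / real (Suc i) \<le> 1 / real (Suc N)" "1 / real (Suc j) \<le> 1 / real (Suc N)"
        using that by (auto simp: field_simps)
      with close[of i j] N have "(norm (fst (c i) - fst (c j)))\<^sup>2 < e\<^sup>2" by linarith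
      thus ?thesis unfolding dist_norm using \<open>0 < e\<close> by (simp add: power2_less_imp_less)
    qed
    thus "\<exists>N. \<forall>i\<ge>N. \<forall>j\<ge>N. dist (fst (c i)) (fst (c j)) < e" by blast
  qed
  then obtain w where w: "(\<lambda>n. fst (c n)) \<longlonglongrightarrow> w"
    using Cauchy_convergent_iff convergent_def by blast
  have "(\<lambda>n. 1 / real (Suc n)) \<longlonglongrightarrow> 0" by (rule LIMSEQ_Suc[OF lim_1_over_n])
  from tendsto_add[OF tendsto_const[of m] this]
  have up: "(\<lambda>n. m + 1 / real (Suc n)) \<longlonglongrightarrow> m" by simp
  have "(\<lambda>n. J (c n)) \<longlonglongrightarrow> m"
    by (rule tendsto_sandwich[OF _ _ tendsto_const[of m] up])
       (intro always_eventually allI less_imp_le[OF cm] m_le cC)+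
  from tendsto_diff[OF this, of "\<lambda>n. (norm (fst (c n)))\<^sup>2 / 2" "(norm w)\<^sup>2 / 2"]
  have r: "(\<lambda>n. snd (c n)) \<longlonglongrightarrow> m - (norm w)\<^sup>2 / 2"
    using w by (simp add: J_def tendsto_intros)
  define r where "r = m - (norm w)\<^sup>2 / 2"
  have "(\<lambda>n. (fst (c n), snd (c n))) \<longlonglongrightarrow> (w, r)"
    using w r unfolding r_def by (rule tendsto_Pair)
  hence wr: "(w, r) \<in> C" using cl cC by (auto intro: closed_sequentially)
  have "r \<le> r' + w \<bullet> (w' - w)" if w': "(w', r') \<in> C" for w' r'
  proof -
    \<comment> \<open>Minimality along the segment towards the competitor, divided by the length of the step.\<close>
    have le: "0 \<le> (r' - r + w \<bullet> (w' - w)) + t * ((norm (w' - w))\<^sup>2 / 2)" if t: "0 < t" "t < 1" for t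
    proof -
      have "(1 - t) *\<^sub>R (w, r) + t *\<^sub>R (w', r') \<in> C"
        using t by (intro convexD[OF cv wr w']) auto
      from m_le[OF this] have "0 \<le> t * (r' - r + w \<bullet> (w' - w) + t * ((norm (w' - w))\<^sup>2 / 2))"
        unfolding r_def J_def
        by (simp add: power2_norm_eq_inner algebra_simps inner_commute add_divide_distrib
            diff_divide_distrib)
      thus ?thesis using t by (simp add: zero_le_mult_iff)
    qed
    have "((\<lambda>t. (r' - r + w \<bullet> (w' - w)) + t * ((norm (w' - w))\<^sup>2 / 2))
        \<longlongrightarrow> (r' - r + w \<bullet> (w' - w)) + 0 * ((norm (w' - w))\<^sup>2 / 2)) (at_right 0)"
      by (intro tendsto_intros)
    moreover have "eventually (\<lambda>t. 0 \<le> (r' - r + w \<bullet> (w' - w)) + t * ((norm (w' - w))\<^sup>2 / 2))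
        (at_right (0::real))"
      unfolding eventually_at_right_field using le by (intro exI[of _ 1]) auto
    ultimately have "0 \<le> r' - r + w \<bullet> (w' - w)"
      by (auto dest: tendsto_lowerbound)
    thus ?thesis by linarith
  qed
  with wr that show thesis by blast
qed

text \<open>
  This is Minty's theorem for the step 1 and the point 0: a maximal monotone graph contains a pair
  \<open>(a, - a)\<close>. The Fitzpatrick function dominates the duality product \<open>p \<bullet> q\<close> by maximality, so adding
  half the squared norm keeps it nonnegative, and on the graph it equals the duality product. Testing
  the optimality condition of the minimiser \<open>(p, q)\<close> with points of the graph says that \<open>(- q, - p)\<close>
  is monotonically related to the graph, hence belongs to it, and testing it at this very point
  forces \<open>p + q = 0\<close>.
\<close>

lemma monotone_graph_meets_antidiagonal:
  fixes G :: "('h::{real_inner, complete_space} \<times> 'h) set"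
  assumes mono: "\<And>y v z u. (y, v) \<in> G \<Longrightarrow> (z, u) \<in> G \<Longrightarrow> 0 \<le> (y - z) \<bullet> (v - u)"
    and max: "\<And>a b. (\<And>y v. (y, v) \<in> G \<Longrightarrow> 0 \<le> (a - y) \<bullet> (b - v)) \<Longrightarrow> (a, b) \<in> G"
  shows "\<exists>a. (a, - a) \<in> G"
proof -
  \<comment> \<open>The epigraph of the Fitzpatrick function of the graph.\<close>
  define C where
    "C = (\<Inter>(y, v)\<in>G. {c :: ('h \<times> 'h) \<times> real. ((v, y), - 1) \<bullet> c \<le> y \<bullet> v})"
  have C_iff: "((p, q), r) \<in> C \<longleftrightarrow> (\<forall>(y, v)\<in>G. p \<bullet> v + y \<bullet> q - y \<bullet> v \<le> r)" for p q r
    by (auto simp: C_def inner_commute algebra_simps)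
  have G_C: "((y, v), y \<bullet> v) \<in> C" if "(y, v) \<in> G" for y v
    unfolding C_iff using mono[OF that] by (auto simp: inner_diff algebra_simps)
  have above: "p \<bullet> q \<le> r" if "((p, q), r) \<in> C" for p q r
  proof (cases "(p, q) \<in> G")
    case True
    with that have "p \<bullet> q + p \<bullet> q - p \<bullet> q \<le> r" unfolding C_iff by blast
    thus ?thesis by simp
  next
    case False
    with max obtain y v where "(y, v) \<in> G" "(p - y) \<bullet> (q - v) < 0" by (meson not_le)
    with that show ?thesis unfolding C_iff by (fastforce simp: inner_diff algebra_simps)
  qed
  have "closed C" unfolding C_def
    by (auto intro!: closed_INT closed_halfspace_le)
  moreover have "convex C" unfolding C_def
    by (auto intro!: convex_INT convex_halfspace_le)
  moreover have "C \<noteq> {}"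
    using G_C max[of 0 0] by blast
  moreover have "0 \<le> r + (norm w)\<^sup>2 / 2" if "(w, r) \<in> C" for w r
  proof (cases w)
    case (Pair p q)
    have "0 \<le> (p + q) \<bullet> (p + q)" by simp
    also have "\<dots> \<le> 2 * r + (norm w)\<^sup>2"
      using above[of p q r] that unfolding Pair norm_Pair
      by (simp add: power2_norm_eq_inner algebra_simps inner_commute)
    finally show ?thesis by simp
  qed
  ultimately obtain w r where wr: "(w, r) \<in> C"
    and opt: "\<And>w' r'. (w', r') \<in> C \<Longrightarrow> r \<le> r' + w \<bullet> (w' - w)"
    using strongly_convex_minimum by metis
  obtain p q where w: "w = (p, q)" by (cases w)
  have key: "(p + q) \<bullet> (p + q) \<le> (y + q) \<bullet> (v + p)" if "(y, v) \<in> G" for y v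
    using opt[OF G_C[OF that]] above[of p q r] wr
    by (simp add: w algebra_simps inner_commute)
  have "(- q, - p) \<in> G"
  proof (rule max)
    fix y v assume "(y, v) \<in> G"
    from key[OF this] have "0 \<le> (y + q) \<bullet> (v + p)"
      using inner_ge_zero[of "p + q"] by linarith
    thus "0 \<le> (- q - y) \<bullet> (- p - v)" by (simp add: algebra_simps)
  qed
  from key[OF this] have "(p + q) \<bullet> (p + q) = 0" by (intro antisym) auto
  hence "p + q = 0" by simp
  hence "- q = p" by (simp add: add.commute eq_neg_iff_add_eq_0 neg_eq_iff_add_eq_0)
  with \<open>(- q, - p) \<in> G\<close> show ?thesis by auto
qed

text \<open>
  Rescaling and translating the values reduces the claim to \<open>monotone_graph_meets_antidiagonal\<close>.
\<close>

theorem minty: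
  fixes T :: "'h::{real_inner, complete_space} \<Rightarrow> 'h set"
  assumes T: "maximal_monotone T" and l: "0 < l"
  shows "\<exists>y. \<exists>u\<in>T y. x = y + l *\<^sub>R u"
proof -
  define G where "G = {(y, l *\<^sub>R u - x) |y u. u \<in> T y}"
  have "\<exists>a. (a, - a) \<in> G"
  proof (rule monotone_graph_meets_antidiagonal)
    fix y v z u assume "(y, v) \<in> G" "(z, u) \<in> G"
    then obtain v' u' where v': "v = l *\<^sub>R v' - x" "v' \<in> T y" and u': "u = l *\<^sub>R u' - x" "u' \<in> T z"
      by (auto simp: G_def)
    have "(y - z) \<bullet> (v - u) = l * ((y - z) \<bullet> (v' - u'))"
      by (simp add: v' u' algebra_simps)
    thus "0 \<le> (y - z) \<bullet> (v - u)"
      using maximal_monotone_monotone[OF T v'(2) u'(2)] l by simp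
  next
    fix a b assume rel: "\<And>y v. (y, v) \<in> G \<Longrightarrow> 0 \<le> (a - y) \<bullet> (b - v)"
    have "(1 / l) *\<^sub>R (b + x) \<in> T a"
    proof (rule maximal_monotone_mem[OF T])
      fix y v assume "v \<in> T y"
      hence "0 \<le> (a - y) \<bullet> (b - (l *\<^sub>R v - x))" by (intro rel) (auto simp: G_def)
      also have "b - (l *\<^sub>R v - x) = l *\<^sub>R ((1 / l) *\<^sub>R (b + x) - v)"
        using l by (simp add: algebra_simps)
      finally show "0 \<le> (a - y) \<bullet> ((1 / l) *\<^sub>R (b + x) - v)" using l by (simp add: zero_le_mult_iff)
    qed
    moreover have "b = l *\<^sub>R ((1 / l) *\<^sub>R (b + x)) - x" using l by simp
    ultimately show "(a, b) \<in> G" unfolding G_def by blast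
  qed
  then obtain a u where "u \<in> T a" "- a = l *\<^sub>R u - x" by (auto simp: G_def)
  thus ?thesis by (metis add_diff_cancel_left' add_uminus_conv_diff diff_add_cancel minus_diff_eq)
qed

lemma resolvent_unique:
  assumes T: "maximal_monotone T" and l: "0 < l"
    and "u \<in> T y" "v \<in> T z" "y + l *\<^sub>R u = z + l *\<^sub>R v"
  shows "y = z"
proof -
  have "y - z = - l *\<^sub>R (u - v)" using assms(5) by (simp add: algebra_simps)
  hence "(y - z) \<bullet> (y - z) = - l * ((y - z) \<bullet> (u - v))" by (metis inner_scaleR_right)
  also have "\<dots> \<le> 0" using maximal_monotone_monotone[OF T assms(3,4)] l by simp
  finally have "(y - z) \<bullet> (y - z) = 0" using inner_ge_zero[of "y - z"] by linarith
  thus ?thesis by simp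
qed

lemma yosida_mem:
  fixes T :: "'h::{real_inner, complete_space} \<Rightarrow> 'h set"
  assumes T: "maximal_monotone T" and l: "0 < l"
  shows "yosida l T x \<in> T (resolvent l T x)"
proof -
  obtain y u where yu: "u \<in> T y" "x = y + l *\<^sub>R u" using minty[OF T l] by blast
  have "{y. \<exists>u\<in>T y. x = y + l *\<^sub>R u} = {y}"
    using yu resolvent_unique[OF T l] by blast
  hence "resolvent l T x = y" by (simp add: resolvent_def)
  thus ?thesis using yu l by (simp add: yosida_def)
qed

lemma resolvent_yosida:
  assumes "l \<noteq> 0"
  shows "resolvent l T x + l *\<^sub>R yosida l T x = x"
  using assms by (simp add: yosida_def)

lemma resolvent_nonexpansive:
  fixes T :: "'h::{real_inner, complete_space} \<Rightarrow> 'h set"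
  assumes T: "maximal_monotone T" and l: "0 < l"
  shows "norm (resolvent l T x - resolvent l T y) \<le> norm (x - y)"
proof -
  let ?d = "resolvent l T x - resolvent l T y" and ?a = "yosida l T x - yosida l T y"
  have "x - y = ?d + l *\<^sub>R ?a"
    using resolvent_yosida[of l T x] resolvent_yosida[of l T y] l by (simp add: algebra_simps)
  hence "?d \<bullet> (x - y) = ?d \<bullet> ?d + l * (?d \<bullet> ?a)" by (simp add: inner_add_right)
  moreover have "0 \<le> ?d \<bullet> ?a" using maximal_monotone_monotone[OF T yosida_mem[OF T l] yosida_mem[OF T l]] .
  ultimately have "norm ?d * norm ?d \<le> ?d \<bullet> (x - y)"
    using l by (simp flip: power2_eq_square add: power2_norm_eq_inner)
  also have "\<dots> \<le> norm ?d * norm (x - y)" by (rule norm_cauchy_schwarz)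
  finally show ?thesis
    by (cases "?d = 0") (auto simp: mult_le_cancel_left)
qed

text \<open>
  The basic inequality of the proof. Expanding \<open>|x - z|\<^sup>2\<close> around the resolvent leaves the monotonicity
  term between the resolvent and \<open>z\<close>; moving the selection from there to \<open>x\<close> costs
  \<open>2 l\<^sup>2 (f \<bullet> yosida l T x)\<close>, which the two quadratic terms absorb.
\<close>

lemma resolvent_energy_decrease:
  fixes T :: "'h::{real_inner, complete_space} \<Rightarrow> 'h set"
  assumes T: "maximal_monotone T" and l: "0 < l" and f: "f \<in> T z"
  shows "(norm (resolvent l T x - z))\<^sup>2 + (norm (x - resolvent l T x))\<^sup>2 / 2
    \<le> (norm (x - z))\<^sup>2 - 2 * l * (f \<bullet> (x - z)) + 2 * l\<^sup>2 * (norm f)\<^sup>2"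
proof -
  let ?y = "resolvent l T x" and ?a = "yosida l T x"
  have x: "x = ?y + l *\<^sub>R ?a" using resolvent_yosida[of l T x] l by simp
  have "0 \<le> (?y - z) \<bullet> (?a - f)"
    by (rule maximal_monotone_monotone[OF T yosida_mem[OF T l] f])
  hence 1: "0 \<le> 2 * l * ((?y - z) \<bullet> (?a - f))" using l by simp
  have 2: "0 \<le> l\<^sup>2 / 2 * ((?a - 2 *\<^sub>R f) \<bullet> (?a - 2 *\<^sub>R f))" by simp
  have 3: "(norm (x - ?y))\<^sup>2 = l\<^sup>2 * (?a \<bullet> ?a)"
    by (subst (1) x) (simp add: power_mult_distrib power2_norm_eq_inner)
  \<comment> \<open>The slack is the monotonicity term plus a complete square.\<close>
  have "(norm (x - z))\<^sup>2 - 2 * l * (f \<bullet> (x - z)) + 2 * l\<^sup>2 * (norm f)\<^sup>2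
      - ((norm (?y - z))\<^sup>2 + l\<^sup>2 * (?a \<bullet> ?a) / 2)
    = 2 * l * ((?y - z) \<bullet> (?a - f)) + l\<^sup>2 / 2 * ((?a - 2 *\<^sub>R f) \<bullet> (?a - 2 *\<^sub>R f))"
    unfolding power2_norm_eq_inner
    by (subst (1 2 3) x) (simp add: inner_commute power2_eq_square algebra_simps)
  with 1 2 3 show ?thesis by linarith
qed

section \<open>Square-integrable martingale differences\<close>

text \<open>
  Conditional expectations are avoided: that \<open>d k\<close> has conditional mean zero given \<open>F k\<close> is expressed by
  orthogonality to all square-integrable \<open>F k\<close>-measurable functions.
\<close>

locale L2_martingale_differences = prob_space +
  fixes F :: "nat \<Rightarrow> 'a measure" and d :: "nat \<Rightarrow> 'a \<Rightarrow> real"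
  assumes subalg: "\<And>k. subalgebra M (F k)"
    and F_mono: "\<And>k l. k \<le> l \<Longrightarrow> sets (F k) \<subseteq> sets (F l)"
    and adapted: "\<And>k. d k \<in> borel_measurable (F (Suc k))"
    and square_integrable: "\<And>k. integrable M (\<lambda>\<omega>. (d k \<omega>)\<^sup>2)"
    and orthogonal: "\<And>k g. g \<in> borel_measurable (F k) \<Longrightarrow> integrable M (\<lambda>\<omega>. (g \<omega>)\<^sup>2) \<Longrightarrow>
      expectation (\<lambda>\<omega>. d k \<omega> * g \<omega>) = 0"
begin

lemma adapted_later: "k < l \<Longrightarrow> d k \<in> borel_measurable (F l)"
  using adapted[of k] F_mono[of "Suc k" l] subalg
  by (auto intro!: measurable_mono[THEN subsetD, of borel borel "F (Suc k)" "F l"]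
      simp: subalgebra_def Suc_le_eq)

lemma measurable_d [measurable]: "d k \<in> borel_measurable M"
  by (rule measurable_from_subalg[OF subalg adapted])

lemma shifted: "L2_martingale_differences M (\<lambda>k. F (m + k)) (\<lambda>k. d (m + k))"
  by unfold_locales (use subalg F_mono adapted square_integrable orthogonal in auto)

text \<open>
  The variance bound for a martingale transform with predictable weights in \<open>[-1, 1]\<close>. Stopping is a
  transform of this kind, which is what the maximal inequality uses.
\<close>

lemma transform_second_moment:
  assumes h: "\<And>k. h k \<in> borel_measurable (F k)" "\<And>k \<omega>. \<bar>h k \<omega>\<bar> \<le> 1"
  shows "(\<lambda>\<omega>. \<Sum>k<n. h k \<omega> * d k \<omega>) \<in> borel_measurable (F n)"
    and "integrable M (\<lambda>\<omega>. (\<Sum>k<n. h k \<omega> * d k \<omega>)\<^sup>2)"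
    and "expectation (\<lambda>\<omega>. (\<Sum>k<n. h k \<omega> * d k \<omega>)\<^sup>2) \<le> (\<Sum>k<n. expectation (\<lambda>\<omega>. (d k \<omega>)\<^sup>2))"
proof -
  have hF: "h k \<in> borel_measurable (F l)" if "k \<le> l" for k l
    using h(1)[of k] F_mono[OF that] subalg
    by (auto intro!: measurable_mono[THEN subsetD, of borel borel "F k" "F l"] simp: subalgebra_def)
  have [measurable]: "h k \<in> borel_measurable M" for k
    by (rule measurable_from_subalg[OF subalg h(1)])
  have meas: "(\<lambda>\<omega>. \<Sum>k<n. h k \<omega> * d k \<omega>) \<in> borel_measurable (F n)" for n
    by (intro borel_measurable_sum borel_measurable_times hF adapted_later) auto
  have hd2: "(h k \<omega> * d k \<omega>)\<^sup>2 \<le> (d k \<omega>)\<^sup>2" for k \<omega>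
    using h(2)[of k \<omega>] mult_right_mono[of "(h k \<omega>)\<^sup>2" 1 "(d k \<omega>)\<^sup>2"]
    by (simp add: power_mult_distrib abs_square_le_1)
  have hd_int: "integrable M (\<lambda>\<omega>. (h k \<omega> * d k \<omega>)\<^sup>2)" for k
    by (rule Bochner_Integration.integrable_bound[OF square_integrable[of k]]) (use hd2 in auto)
  have "integrable M (\<lambda>\<omega>. (\<Sum>k<n. h k \<omega> * d k \<omega>)\<^sup>2) \<and>
    expectation (\<lambda>\<omega>. (\<Sum>k<n. h k \<omega> * d k \<omega>)\<^sup>2) \<le> (\<Sum>k<n. expectation (\<lambda>\<omega>. (d k \<omega>)\<^sup>2))"
  proof (induction n)
    case (Suc n)
    define S where "S \<omega> = (\<Sum>k<n. h k \<omega> * d k \<omega>)" for \<omega>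
    define g where "g \<omega> = 2 * h n \<omega> * S \<omega>" for \<omega>
    have S_int: "integrable M (\<lambda>\<omega>. (S \<omega>)\<^sup>2)" using Suc by (simp add: S_def)
    have gF: "g \<in> borel_measurable (F n)"
      unfolding g_def S_def by (intro borel_measurable_times meas h(1)) auto
    have [measurable]: "g \<in> borel_measurable M" by (rule measurable_from_subalg[OF subalg gF])
    have g2: "(g \<omega>)\<^sup>2 \<le> 4 * (S \<omega>)\<^sup>2" for \<omega>
      using h(2)[of n \<omega>] mult_right_mono[of "(h n \<omega>)\<^sup>2" 1 "(S \<omega>)\<^sup>2"]
      by (simp add: g_def power_mult_distrib abs_square_le_1)
    have g_int: "integrable M (\<lambda>\<omega>. (g \<omega>)\<^sup>2)"
      by (rule Bochner_Integration.integrable_bound[OF integrable_mult_right[OF S_int, of 4]])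
        (use g2 in auto)
    have dg_int: "integrable M (\<lambda>\<omega>. d n \<omega> * g \<omega>)"
    proof (rule Bochner_Integration.integrable_bound)
      show "integrable M (\<lambda>\<omega>. (d n \<omega>)\<^sup>2 + (g \<omega>)\<^sup>2)"
        using square_integrable g_int by simp
      have "\<bar>a * b\<bar> \<le> a\<^sup>2 + b\<^sup>2" for a b :: real
      proof -
        have "2 * \<bar>a * b\<bar> \<le> a\<^sup>2 + b\<^sup>2"
          using sum_squares_bound[of "\<bar>a\<bar>" "\<bar>b\<bar>"] by (simp add: abs_mult)
        thus ?thesis using abs_ge_zero[of "a * b"] by linarith
      qed
      thus "AE \<omega> in M. norm (d n \<omega> * g \<omega>) \<le> norm ((d n \<omega>)\<^sup>2 + (g \<omega>)\<^sup>2)" by simp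
    qed auto
    have eq: "(\<Sum>k<Suc n. h k \<omega> * d k \<omega>)\<^sup>2 = (S \<omega>)\<^sup>2 + d n \<omega> * g \<omega> + (h n \<omega> * d n \<omega>)\<^sup>2" for \<omega>
      by (simp add: S_def g_def power2_sum mult_ac)
    have "expectation (\<lambda>\<omega>. (h n \<omega> * d n \<omega>)\<^sup>2) \<le> expectation (\<lambda>\<omega>. (d n \<omega>)\<^sup>2)"
      by (rule integral_mono[OF hd_int square_integrable hd2])
    thus ?case
      using Suc S_int dg_int hd_int orthogonal[OF gF g_int] unfolding eq
      by (simp add: S_def[symmetric])
  qed simp
  thus "(\<lambda>\<omega>. \<Sum>k<n. h k \<omega> * d k \<omega>) \<in> borel_measurable (F n)"
    "integrable M (\<lambda>\<omega>. (\<Sum>k<n. h k \<omega> * d k \<omega>)\<^sup>2)"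
    "expectation (\<lambda>\<omega>. (\<Sum>k<n. h k \<omega> * d k \<omega>)\<^sup>2) \<le> (\<Sum>k<n. expectation (\<lambda>\<omega>. (d k \<omega>)\<^sup>2))"
    using meas by auto
qed

text \<open>
  Stop the partial sums as soon as they reach the level \<open>e\<close>. If the level is reached at all, the stopped
  sum at the final time still has absolute value at least \<open>e\<close>, so Chebyshev's inequality for this single
  variable controls the maximum.
\<close>

lemma kolmogorov_maximal_inequality:
  assumes e: "0 < e"
  shows "prob {\<omega>\<in>space M. \<exists>j\<le>n. e \<le> \<bar>\<Sum>k<j. d k \<omega>\<bar>} \<le> (\<Sum>k<n. expectation (\<lambda>\<omega>. (d k \<omega>)\<^sup>2)) / e\<^sup>2"
proof -
  define S where "S j \<omega> = (\<Sum>k<j. d k \<omega>)" for j \<omega>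
  \<comment> \<open>The weight is 1 until the first passage over the level and 0 from then on.\<close>
  define h where "h k \<omega> = (if \<forall>j\<in>{..k}. \<bar>S j \<omega>\<bar> < e then 1 else 0 :: real)" for k \<omega>
  define T where "T \<omega> = (\<Sum>k<n. h k \<omega> * d k \<omega>)" for \<omega>
  have SF: "S j \<in> borel_measurable (F k)" if "j \<le> k" for j k
    unfolding S_def using that by (intro borel_measurable_sum adapted_later) auto
  have hF: "h k \<in> borel_measurable (F k)" for k
  proof -
    have "Measurable.pred (F k) (\<lambda>\<omega>. \<bar>S j \<omega>\<bar> < e)" if "j \<in> {..k}" for j
    proof -
      have [measurable]: "S j \<in> borel_measurable (F k)" using SF that by simp
      show ?thesis by measurable
    qed
    hence [measurable]: "Measurable.pred (F k) (\<lambda>\<omega>. \<forall>j\<in>{..k}. \<bar>S j \<omega>\<bar> < e)"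
      by (intro pred_intros_finite) auto
    show ?thesis unfolding h_def by measurable
  qed
  have h1: "\<bar>h k \<omega>\<bar> \<le> 1" for k \<omega> by (simp add: h_def)
  have T_int: "integrable M (\<lambda>\<omega>. (T \<omega>)\<^sup>2)"
    and T_le: "expectation (\<lambda>\<omega>. (T \<omega>)\<^sup>2) \<le> (\<Sum>k<n. expectation (\<lambda>\<omega>. (d k \<omega>)\<^sup>2))"
    unfolding T_def by (rule transform_second_moment[OF hF h1])+
  have [measurable]: "T \<in> borel_measurable M"
    unfolding T_def by (rule measurable_from_subalg[OF subalg transform_second_moment(1)[OF hF h1]])
  have stopped: "e \<le> \<bar>T \<omega>\<bar>" if ex: "\<exists>j\<le>n. e \<le> \<bar>S j \<omega>\<bar>" for \<omega>
  proof -
    define j where "j = (LEAST j. e \<le> \<bar>S j \<omega>\<bar>)"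
    obtain j0 where j0: "j0 \<le> n" "e \<le> \<bar>S j0 \<omega>\<bar>" using ex by blast
    have j: "e \<le> \<bar>S j \<omega>\<bar>" "j \<le> n"
      unfolding j_def using LeastI[of "\<lambda>j. e \<le> \<bar>S j \<omega>\<bar>", OF j0(2)]
        Least_le[of "\<lambda>j. e \<le> \<bar>S j \<omega>\<bar>", OF j0(2)] j0(1) by auto
    have before: "\<bar>S i \<omega>\<bar> < e" if "i < j" for i
      using not_less_Least[of i "\<lambda>j. e \<le> \<bar>S j \<omega>\<bar>"] that by (auto simp: j_def)
    have hk: "h k \<omega> = (if k < j then 1 else 0)" for k
    proof (cases "k < j")
      case True
      thus ?thesis using before by (simp add: h_def)
    next
      case False
      hence "j \<in> {..k}" by simp
      hence "\<not> (\<forall>j\<in>{..k}. \<bar>S j \<omega>\<bar> < e)" using j(1) by (meson not_less)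
      thus ?thesis using False by (simp add: h_def)
    qed
    have "T \<omega> = (\<Sum>k\<in>{..<n}. if k < j then d k \<omega> else 0)"
      unfolding T_def by (intro sum.cong) (auto simp: hk)
    also have "\<dots> = S j \<omega>"
      unfolding S_def by (rule sum.mono_neutral_cong_right) (use j(2) in auto)
    finally show ?thesis using j(1) by simp
  qed
  have "prob {\<omega>\<in>space M. \<exists>j\<le>n. e \<le> \<bar>S j \<omega>\<bar>} \<le> prob {\<omega>\<in>space M. e \<le> \<bar>T \<omega>\<bar>}"
    by (rule finite_measure_mono) (use stopped in auto)
  also have "\<dots> \<le> expectation (\<lambda>\<omega>. (T \<omega>)\<^sup>2) / e\<^sup>2"
    by (rule second_moment_method) (use T_int e in auto)
  also have "\<dots> \<le> (\<Sum>k<n. expectation (\<lambda>\<omega>. (d k \<omega>)\<^sup>2)) / e\<^sup>2"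
    using T_le by (rule divide_right_mono) simp
  finally show ?thesis by (simp add: S_def)
qed

lemma maximal_inequality_infinite:
  assumes e: "0 < e" and sm: "summable (\<lambda>k. expectation (\<lambda>\<omega>. (d k \<omega>)\<^sup>2))"
  shows "prob {\<omega>\<in>space M. \<exists>j. e \<le> \<bar>\<Sum>k<j. d k \<omega>\<bar>} \<le> (\<Sum>k. expectation (\<lambda>\<omega>. (d k \<omega>)\<^sup>2)) / e\<^sup>2"
proof -
  define B where "B n = {\<omega>\<in>space M. \<exists>j\<le>n. e \<le> \<bar>\<Sum>k<j. d k \<omega>\<bar>}" for n
  have [measurable]: "B n \<in> events" for n unfolding B_def by measurable
  have "incseq B" by (auto simp: B_def incseq_def) (meson order_trans)
  hence "(\<lambda>n. prob (B n)) \<longlonglongrightarrow> prob (\<Union>n. B n)" by (intro finite_Lim_measure_incseq) auto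
  moreover have "(\<Union>n. B n) = {\<omega>\<in>space M. \<exists>j. e \<le> \<bar>\<Sum>k<j. d k \<omega>\<bar>}"
    by (auto simp: B_def)
  moreover have "prob (B n) \<le> (\<Sum>k. expectation (\<lambda>\<omega>. (d k \<omega>)\<^sup>2)) / e\<^sup>2" for n
    unfolding B_def
    by (rule order_trans[OF kolmogorov_maximal_inequality[OF e]])
       (auto intro!: divide_right_mono sum_le_suminf sm)
  ultimately show ?thesis by (auto intro: LIMSEQ_le_const2)
qed

text \<open>
  The maximal inequality applied to the tails: the oscillation beyond the index \<open>m\<close> exceeds \<open>e\<close> with
  probability at most the remaining variance over \<open>e\<^sup>2\<close>, which tends to zero, so the partial sums are
  almost surely Cauchy.
\<close>

theorem AE_summable:
  assumes sm: "summable (\<lambda>k. expectation (\<lambda>\<omega>. (d k \<omega>)\<^sup>2))"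
  shows "AE \<omega> in M. summable (\<lambda>k. d k \<omega>)"
proof -
  define v where "v k = expectation (\<lambda>\<omega>. (d k \<omega>)\<^sup>2)" for k
  have small: "AE \<omega> in M. \<exists>m. \<forall>j. \<bar>\<Sum>k<j. d (m + k) \<omega>\<bar> < e" if e: "0 < e" for e
  proof -
    define B where "B m = {\<omega>\<in>space M. \<exists>j. e \<le> \<bar>\<Sum>k<j. d (m + k) \<omega>\<bar>}" for m
    have [measurable]: "B m \<in> events" for m unfolding B_def by measurable
    have B_le: "prob (B m) \<le> (\<Sum>k. v (m + k)) / e\<^sup>2" for m
    proof -
      interpret sh: L2_martingale_differences M "\<lambda>k. F (m + k)" "\<lambda>k. d (m + k)" by (rule shifted)
      show ?thesis unfolding B_def v_def
        by (rule sh.maximal_inequality_infinite[OF e])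
           (use summable_ignore_initial_segment[OF sm, of m] in \<open>simp add: add.commute\<close>)
    qed
    have "(\<lambda>m. \<Sum>k. v (k + m)) \<longlonglongrightarrow> 0"
      using suminf_exist_split2[OF sm] by (simp add: v_def)
    hence "(\<lambda>m. (\<Sum>k. v (m + k)) / e\<^sup>2) \<longlonglongrightarrow> 0 / e\<^sup>2"
      by (intro tendsto_divide tendsto_const) (use e in \<open>auto simp: add.commute\<close>)
    moreover have "prob (\<Inter>m. B m) \<le> (\<Sum>k. v (m + k)) / e\<^sup>2" for m
      by (rule order_trans[OF finite_measure_mono B_le[of m]]) auto
    ultimately have "prob (\<Inter>m. B m) \<le> 0"
      by (intro LIMSEQ_le_const[of "\<lambda>m. (\<Sum>k. v (m + k)) / e\<^sup>2"]) auto
    hence "prob (\<Inter>m. B m) = 0" by (simp add: measure_le_0_iff)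
    moreover have "(\<Inter>m. B m) \<in> events" by measurable
    ultimately have "AE \<omega> in M. \<omega> \<notin> (\<Inter>m. B m)" by (simp add: prob_eq_0)
    thus ?thesis by (rule AE_mp) (auto simp: B_def not_le intro!: AE_I2)
  qed
  have "AE \<omega> in M. \<forall>r. \<exists>m. \<forall>j. \<bar>\<Sum>k<j. d (m + k) \<omega>\<bar> < 1 / real (Suc r)"
    by (subst AE_all_countable) (auto intro!: small)
  thus ?thesis
  proof (rule AE_mp, intro AE_I2 impI)
    fix \<omega> assume small: "\<forall>r. \<exists>m. \<forall>j. \<bar>\<Sum>k<j. d (m + k) \<omega>\<bar> < 1 / real (Suc r)"
    show "summable (\<lambda>k. d k \<omega>)"
      unfolding summable_Cauchy
    proof (intro allI impI)
      fix e :: real assume "0 < e"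
      then obtain r where r: "1 / real (Suc r) < e / 2"
        using nat_approx_posE[of "e / 2"] by auto
      obtain m where m: "\<And>j. \<bar>\<Sum>k<j. d (m + k) \<omega>\<bar> < 1 / real (Suc r)" using small by blast
      have from_m: "\<bar>\<Sum>k=m..<l. d k \<omega>\<bar> < e / 2" if "m \<le> l" for l
      proof -
        have "(\<Sum>k=m..<l. d k \<omega>) = (\<Sum>k<l - m. d (m + k) \<omega>)"
          using sum.shift_bounds_nat_ivl[of "\<lambda>k. d k \<omega>" 0 m "l - m"] that
          by (simp add: lessThan_atLeast0 add.commute)
        thus ?thesis using m[of "l - m"] r by linarith
      qed
      have "norm (\<Sum>k=a..<b. d k \<omega>) < e" if "m \<le> a" for a b
      proof (cases "a \<le> b")
        case True
        hence "(\<Sum>k=m..<a. d k \<omega>) + (\<Sum>k=a..<b. d k \<omega>) = (\<Sum>k=m..<b. d k \<omega>)"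
          using that by (simp add: sum.atLeastLessThan_concat)
        moreover have "\<bar>\<Sum>k=m..<a. d k \<omega>\<bar> < e / 2" "\<bar>\<Sum>k=m..<b. d k \<omega>\<bar> < e / 2"
          using from_m that True by auto
        ultimately show ?thesis unfolding real_norm_def by linarith
      qed (use \<open>0 < e\<close> in simp)
      thus "\<exists>N. \<forall>m\<ge>N. \<forall>n. norm (sum (\<lambda>k. d k \<omega>) {m..<n}) < e" by blast
    qed
  qed
qed

end

section \<open>Functions measurable in one variable and continuous in the other\<close>

text \<open>
  Replacing the continuous variable by the first member of a dense sequence that lies within
  \<open>1 / (k + 1)\<close> of it gives, for each \<open>k\<close>, a countable gluing of measurable functions; these converge
  pointwise.
\<close>

lemma borel_measurable_Caratheodory:
  fixes f :: "'e \<Rightarrow> 'h::{metric_space, second_countable_topology} \<Rightarrow> 'k::metric_space"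
  assumes meas: "\<And>y. (\<lambda>s. f s y) \<in> borel_measurable M"
    and cont: "\<And>s. s \<in> space M \<Longrightarrow> continuous_on UNIV (f s)"
  shows "(\<lambda>(s, y). f s y) \<in> borel_measurable (M \<Otimes>\<^sub>M borel)"
proof -
  obtain D :: "'h set" where D: "countable D" "\<And>U. open U \<Longrightarrow> U \<noteq> {} \<Longrightarrow> \<exists>d\<in>D. d \<in> U"
    using countable_dense_exists by blast
  have "D \<noteq> {}" using D(2)[of UNIV] by auto
  define q where "q = from_nat_into D"
  have q: "\<exists>i. dist y (q i) < e" if pos: "0 < e" for y e
  proof -
    obtain d where "d \<in> D" "d \<in> ball y e" using D(2)[of "ball y e"] pos by auto
    thus ?thesis using from_nat_into_surj[OF D(1)] unfolding q_def by (metis mem_ball)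
  qed
  define i where "i k y = (LEAST i. dist y (q i) < 1 / real (Suc k))" for k y
  have i: "dist y (q (i k y)) < 1 / real (Suc k)" for k y
    unfolding i_def by (rule LeastI_ex) (rule q, simp)
  have [measurable]: "i k \<in> borel \<rightarrow>\<^sub>M count_space UNIV" for k
    unfolding i_def by measurable
  have [measurable]: "(\<lambda>s. f s y) \<in> borel_measurable M" for y by (rule meas)
  show ?thesis
  proof (rule borel_measurable_LIMSEQ_metric)
    fix k
    show "(\<lambda>(s, y). f s (q (i k y))) \<in> borel_measurable (M \<Otimes>\<^sub>M borel)"
      unfolding case_prod_beta
      by (rule measurable_compose_countable[where f="\<lambda>j p. f (fst p) (q j)"]) measurable
  next
    fix p assume "p \<in> space (M \<Otimes>\<^sub>M (borel :: 'h measure))"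
    then obtain s y where p: "p = (s, y)" "s \<in> space M" by (auto simp: space_pair_measure)
    have "dist (q (i k y)) y \<le> dist (1 / real (Suc k)) 0" for k
      using i[of y k] by (simp add: dist_commute)
    hence "(\<lambda>k. q (i k y)) \<longlonglongrightarrow> y"
      by (intro metric_tendsto_imp_tendsto[OF LIMSEQ_Suc[OF lim_1_over_n[where 'a=real]]] always_eventually) auto
    from continuous_on_tendsto_compose[OF cont[OF p(2)] this]
    show "(\<lambda>k. case p of (s, y) \<Rightarrow> f s (q (i k y))) \<longlonglongrightarrow> (case p of (s, y) \<Rightarrow> f s y)"
      by (simp add: p)
  qed
qed

section \<open>Recursions driven by independent samples\<close>

locale iid_recursion = prob_space P + samples: prob_space M
  for P :: "'w measure" and M :: "'e measure" +
  fixes \<xi> :: "nat \<Rightarrow> 'w \<Rightarrow> 'e"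
    and f :: "nat \<Rightarrow> 'e \<Rightarrow> 'h::{real_inner, banach, second_countable_topology} \<Rightarrow> 'h"
    and x0 :: 'h
  assumes indep: "indep_vars (\<lambda>_. M) \<xi> {1..}"
    and law: "\<And>n. 1 \<le> n \<Longrightarrow> distr P M (\<xi> n) = M"
    and f_measurable: "\<And>n. (\<lambda>(s, y). f n s y) \<in> borel_measurable (M \<Otimes>\<^sub>M borel)"
begin

fun X :: "nat \<Rightarrow> 'w \<Rightarrow> 'h" where
  "X 0 \<omega> = x0"
| "X (Suc n) \<omega> = f n (\<xi> (Suc n) \<omega>) (X n \<omega>)"

declare X.simps [simp del]

definition history :: "nat \<Rightarrow> 'w measure" where
  "history n = vimage_algebra (space P) (\<lambda>\<omega>. \<lambda>i\<in>{1..n}. \<xi> i \<omega>) (PiM {1..n} (\<lambda>_. M))"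

lemma sample_measurable: "1 \<le> n \<Longrightarrow> \<xi> n \<in> measurable P M"
  using indep unfolding indep_vars_def by auto

lemma past_measurable: "(\<lambda>\<omega>. \<lambda>i\<in>{1..n}. \<xi> i \<omega>) \<in> measurable P (PiM {1..n} (\<lambda>_. M))"
  by (intro measurable_restrict sample_measurable) auto

lemma space_history [simp]: "space (history n) = space P"
  by (simp add: history_def)

lemma history_subalgebra: "subalgebra P (history n)"
  using past_measurable[of n] measurable_space[OF past_measurable]
  by (auto simp: subalgebra_def history_def sets_vimage_algebra2 measurable_sets)

lemma sample_history:
  assumes "1 \<le> i" "i \<le> n"
  shows "\<xi> i \<in> measurable (history n) M"
proof -
  have "(\<lambda>\<omega>. \<lambda>i\<in>{1..n}. \<xi> i \<omega>) \<in> measurable (history n) (PiM {1..n} (\<lambda>_. M))"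
    unfolding history_def using measurable_space[OF past_measurable]
    by (intro measurable_vimage_algebra1) auto
  from measurable_compose[OF this measurable_component_singleton[of i]]
  show ?thesis using assms by simp
qed

lemma history_mono:
  assumes "k \<le> l"
  shows "sets (history k) \<subseteq> sets (history l)"
proof -
  have "(\<lambda>\<omega>. \<lambda>i\<in>{1..k}. \<xi> i \<omega>) \<in> measurable (history l) (PiM {1..k} (\<lambda>_. M))"
    by (intro measurable_restrict sample_history) (use assms in auto)
  from measurable_sets[OF this] show ?thesis
    using measurable_space[OF past_measurable]
    by (auto simp: history_def[of k] sets_vimage_algebra2)
qed

lemma measurable_history_mono:
  assumes "k \<le> l" "g \<in> measurable (history k) N"
  shows "g \<in> measurable (history l) N"
  using measurable_mono[of N N "history k" "history l"] history_mono[OF assms(1)] assms(2) by auto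

lemma X_adapted: "X n \<in> borel_measurable (history n)"
proof (induction n)
  case (Suc n)
  have "(\<lambda>\<omega>. (\<xi> (Suc n) \<omega>, X n \<omega>)) \<in> measurable (history (Suc n)) (M \<Otimes>\<^sub>M borel)"
    using measurable_history_mono[OF _ Suc, of "Suc n"] sample_history[of "Suc n" "Suc n"]
    by (intro measurable_Pair) auto
  from measurable_compose[OF this f_measurable[of n]] show ?case by (simp add: X.simps)
qed (simp add: X.simps)

lemma X_measurable [measurable]: "X n \<in> borel_measurable P"
  by (rule measurable_from_subalg[OF history_subalgebra X_adapted])

text \<open>
  Events of the history are preimages under the vector of the first \<open>n\<close> samples, so this is the
  independence of two disjoint blocks of samples.
\<close>

lemma next_sample_indep:
  assumes A: "A \<in> sets M" and B: "B \<in> sets (history n)"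
  shows "prob (\<xi> (Suc n) -` A \<inter> B) = prob (\<xi> (Suc n) -` A \<inter> space P) * prob B"
proof -
  let ?now = "\<lambda>\<omega>. \<lambda>i\<in>{Suc n}. \<xi> i \<omega>" and ?past = "\<lambda>\<omega>. \<lambda>i\<in>{1..n}. \<xi> i \<omega>"
  let ?A = "(\<lambda>h. h (Suc n)) -` A \<inter> space (PiM {Suc n} (\<lambda>_. M))"
  have ind: "indep_var (PiM {Suc n} (\<lambda>_. M)) ?now (PiM {1..n} (\<lambda>_. M)) ?past"
    by (rule indep_var_restrict[OF indep]) auto
  have "?past \<in> space P \<rightarrow> space (PiM {1..n} (\<lambda>_. M))"
    using measurable_space[OF past_measurable] by auto
  with B obtain B' where B': "B' \<in> sets (PiM {1..n} (\<lambda>_. M))" "B = ?past -` B' \<inter> space P"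
    unfolding history_def by (auto simp: sets_vimage_algebra2)
  have now: "?now -` ?A \<inter> space P = \<xi> (Suc n) -` A \<inter> space P"
    using measurable_space[OF sample_measurable[of "Suc n"]] by (auto simp: space_PiM)
  have "?A \<in> sets (PiM {Suc n} (\<lambda>_. M))"
    by (rule measurable_sets[OF measurable_component_singleton[of "Suc n" "{Suc n}" "\<lambda>_. M"] A]) simp
  from indep_varD[OF ind this B'(1)]
  have "prob ((\<lambda>\<omega>. (?now \<omega>, ?past \<omega>)) -` (?A \<times> B') \<inter> space P)
      = prob (\<xi> (Suc n) -` A \<inter> space P) * prob B"
    unfolding now B'(2) .
  also have "(\<lambda>\<omega>. (?now \<omega>, ?past \<omega>)) -` (?A \<times> B') \<inter> space P = \<xi> (Suc n) -` A \<inter> B"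
    using now B'(2) by auto
  finally show ?thesis .
qed

text \<open>
  Independence of the next sample from the past, in the form used by Fubini arguments. The statement is
  in terms of laws because the sample and the past take values in different types.
\<close>

lemma joint_law:
  assumes a: "a \<in> measurable M L" and g: "g \<in> measurable (history n) N"
  shows "distr M L a \<Otimes>\<^sub>M distr P N g
    = distr P (L \<Otimes>\<^sub>M N) (\<lambda>\<omega>. (a (\<xi> (Suc n) \<omega>), g \<omega>))"
proof -
  have gP [measurable]: "g \<in> measurable P N" by (rule measurable_from_subalg[OF history_subalgebra g])
  have \<xi> [measurable]: "\<xi> (Suc n) \<in> measurable P M" by (rule sample_measurable) simp
  note a [measurable]
  interpret D: prob_space "distr P N g" by (rule prob_space_distr) fact
  interpret E: prob_space "distr M L a" by (rule samples.prob_space_distr) fact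
  show ?thesis
  proof (rule pair_measure_eqI)
    fix A B assume "A \<in> sets (distr M L a)" "B \<in> sets (distr P N g)"
    hence A [measurable]: "A \<in> sets L" and B [measurable]: "B \<in> sets N" by auto
    let ?A = "a -` A \<inter> space M"
    have A': "?A \<in> sets M" by measurable
    have B': "g -` B \<inter> space P \<in> sets (history n)" using measurable_sets[OF g B] by simp
    have "emeasure (distr M L a) A = emeasure (distr P M (\<xi> (Suc n))) ?A"
      using law[of "Suc n"] by (simp add: emeasure_distr)
    also have "\<dots> = prob (\<xi> (Suc n) -` ?A \<inter> space P)"
      using A' by (simp add: emeasure_distr emeasure_eq_measure)
    finally have "emeasure (distr M L a) A * emeasure (distr P N g) B
        = ennreal (prob (\<xi> (Suc n) -` ?A \<inter> space P) * prob (g -` B \<inter> space P))"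
      by (simp add: emeasure_distr emeasure_eq_measure ennreal_mult)
    also have "\<dots> = prob (\<xi> (Suc n) -` ?A \<inter> (g -` B \<inter> space P))"
      by (simp only: next_sample_indep[OF A' B'])
    also have "\<xi> (Suc n) -` ?A \<inter> (g -` B \<inter> space P)
        = (\<lambda>\<omega>. (a (\<xi> (Suc n) \<omega>), g \<omega>)) -` (A \<times> B) \<inter> space P"
      using measurable_space[OF \<xi>] by auto
    also have "ennreal (prob \<dots>) = emeasure (distr P (L \<Otimes>\<^sub>M N) (\<lambda>\<omega>. (a (\<xi> (Suc n) \<omega>), g \<omega>))) (A \<times> B)"
      by (subst emeasure_distr) (auto simp: emeasure_eq_measure)
    finally show "emeasure (distr M L a) A * emeasure (distr P N g) B = \<dots>" .
  qed (auto simp: D.sigma_finite_measure_axioms E.sigma_finite_measure_axioms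
         cong: sets_pair_measure_cong)
qed

lemma joint_law_sample:
  assumes g: "g \<in> measurable (history n) N"
  shows "distr P (M \<Otimes>\<^sub>M N) (\<lambda>\<omega>. (\<xi> (Suc n) \<omega>, g \<omega>)) = M \<Otimes>\<^sub>M distr P N g"
  using joint_law[OF measurable_ident_sets[OF refl] g] by (simp add: distr_id)

lemma nn_integral_next_sample:
  assumes g: "g \<in> measurable (history n) N"
    and h: "h \<in> borel_measurable (M \<Otimes>\<^sub>M N)"
  shows "(\<integral>\<^sup>+\<omega>. h (\<xi> (Suc n) \<omega>, g \<omega>) \<partial>P) = (\<integral>\<^sup>+\<omega>. (\<integral>\<^sup>+s. h (s, g \<omega>) \<partial>M) \<partial>P)"
proof -
  have gP [measurable]: "g \<in> measurable P N" by (rule measurable_from_subalg[OF history_subalgebra g])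
  have [measurable]: "\<xi> (Suc n) \<in> measurable P M" by (rule sample_measurable) simp
  interpret G: prob_space "distr P N g" by (rule prob_space_distr) fact
  interpret pair_sigma_finite M "distr P N g" ..
  have h' [measurable]: "h \<in> borel_measurable (M \<Otimes>\<^sub>M distr P N g)"
    using h by (simp cong: measurable_cong_sets sets_pair_measure_cong)
  note h [measurable]
  have "(\<integral>\<^sup>+\<omega>. h (\<xi> (Suc n) \<omega>, g \<omega>) \<partial>P) = (\<integral>\<^sup>+p. h p \<partial>distr P (M \<Otimes>\<^sub>M N) (\<lambda>\<omega>. (\<xi> (Suc n) \<omega>, g \<omega>)))"
    by (subst nn_integral_distr) auto
  also have "\<dots> = (\<integral>\<^sup>+p. h p \<partial>(M \<Otimes>\<^sub>M distr P N g))" by (simp only: joint_law_sample[OF g])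
  also have "\<dots> = (\<integral>\<^sup>+y. (\<integral>\<^sup>+s. h (s, y) \<partial>M) \<partial>distr P N g)"
    by (rule nn_integral_snd[symmetric]) (use h' in simp)
  also have "\<dots> = (\<integral>\<^sup>+\<omega>. (\<integral>\<^sup>+s. h (s, g \<omega>) \<partial>M) \<partial>P)"
    by (subst nn_integral_distr) auto
  finally show ?thesis .
qed

lemma integrable_sample_iff:
  fixes \<phi> :: "'e \<Rightarrow> 'c::{banach, second_countable_topology}"
  assumes "\<phi> \<in> borel_measurable M"
  shows "integrable P (\<lambda>\<omega>. \<phi> (\<xi> (Suc n) \<omega>)) \<longleftrightarrow> integrable M \<phi>"
  using integrable_distr_eq[of "\<xi> (Suc n)" P M \<phi>] sample_measurable[of "Suc n"] law[of "Suc n"] assms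
  by simp

lemma integral_sample:
  fixes \<phi> :: "'e \<Rightarrow> 'c::{banach, second_countable_topology}"
  assumes "\<phi> \<in> borel_measurable M"
  shows "expectation (\<lambda>\<omega>. \<phi> (\<xi> (Suc n) \<omega>)) = (\<integral>s. \<phi> s \<partial>M)"
  using integral_distr[of "\<xi> (Suc n)" P M \<phi>] sample_measurable[of "Suc n"] law[of "Suc n"] assms
  by simp

lemma AE_sample:
  assumes "AE s in M. Q s"
  shows "AE \<omega> in P. Q (\<xi> (Suc n) \<omega>)"
proof (rule AE_distrD[where P=Q])
  show "\<xi> (Suc n) \<in> measurable P M" by (rule sample_measurable) simp
  show "AE s in distr P M (\<xi> (Suc n)). Q s"
    by (subst law) (use assms in auto)
qed

lemma indep_product:
  fixes a :: "'e \<Rightarrow> real" and b :: "'w \<Rightarrow> real"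
  assumes a: "integrable M a" and b: "b \<in> borel_measurable (history n)" "integrable P b"
  shows "integrable P (\<lambda>\<omega>. a (\<xi> (Suc n) \<omega>) * b \<omega>)"
    and "expectation (\<lambda>\<omega>. a (\<xi> (Suc n) \<omega>) * b \<omega>) = (\<integral>s. a s \<partial>M) * expectation b"
proof -
  have am: "a \<in> borel_measurable M" using a by simp
  have ind: "indep_var borel (\<lambda>\<omega>. a (\<xi> (Suc n) \<omega>)) borel b"
    unfolding indep_var_distribution_eq
    using joint_law[OF am b(1)] law[of "Suc n"] am sample_measurable[of "Suc n"]
      measurable_from_subalg[OF history_subalgebra b(1)]
      distr_distr[OF am sample_measurable[of "Suc n"]]
    by (auto simp: comp_def)
  have ai: "integrable P (\<lambda>\<omega>. a (\<xi> (Suc n) \<omega>))" using a integrable_sample_iff[OF am] by simp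
  show "integrable P (\<lambda>\<omega>. a (\<xi> (Suc n) \<omega>) * b \<omega>)"
    by (rule indep_var_integrable[OF ind ai b(2)])
  show "expectation (\<lambda>\<omega>. a (\<xi> (Suc n) \<omega>) * b \<omega>) = (\<integral>s. a s \<partial>M) * expectation b"
    using indep_var_lebesgue_integral[OF ind ai b(2)] integral_sample[OF am] by simp
qed

text \<open>
  By Fubini the expectation integrates first over the sample with the past frozen, and this inner
  integral vanishes because \<open>\<phi>\<close> is centred.
\<close>

lemma centred_inner_past:
  fixes \<phi> :: "'e \<Rightarrow> 'h" and W :: "'w \<Rightarrow> 'h"
  assumes \<phi>: "integrable M \<phi>" "(\<integral>s. \<phi> s \<partial>M) = 0"
    and W: "W \<in> borel_measurable (history n)" "integrable P W"
  shows "integrable P (\<lambda>\<omega>. \<phi> (\<xi> (Suc n) \<omega>) \<bullet> W \<omega>)"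
    and "expectation (\<lambda>\<omega>. \<phi> (\<xi> (Suc n) \<omega>) \<bullet> W \<omega>) = 0"
proof -
  have [measurable]: "\<phi> \<in> borel_measurable M" "W \<in> borel_measurable P" "\<xi> (Suc n) \<in> measurable P M"
    using \<phi> W sample_measurable by auto
  show int: "integrable P (\<lambda>\<omega>. \<phi> (\<xi> (Suc n) \<omega>) \<bullet> W \<omega>)"
  proof (rule Bochner_Integration.integrable_bound)
    show "integrable P (\<lambda>\<omega>. norm (\<phi> (\<xi> (Suc n) \<omega>)) * norm (W \<omega>))"
      by (rule indep_product(1)[where a="\<lambda>s. norm (\<phi> s)"]) (use \<phi> W in auto)
  qed (auto simp: Cauchy_Schwarz_ineq2)
  interpret D: prob_space "distr P borel W" by (rule prob_space_distr) simp
  interpret pair_sigma_finite M "distr P borel W" ..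
  have int': "integrable (M \<Otimes>\<^sub>M distr P borel W) (\<lambda>(s, y). \<phi> s \<bullet> y)"
    unfolding joint_law_sample[OF W(1), symmetric]
    using int by (subst integrable_distr_eq) (auto simp: case_prod_beta)
  have "expectation (\<lambda>\<omega>. \<phi> (\<xi> (Suc n) \<omega>) \<bullet> W \<omega>)
      = (\<integral>p. (case p of (s, y) \<Rightarrow> \<phi> s \<bullet> y) \<partial>distr P (M \<Otimes>\<^sub>M borel) (\<lambda>\<omega>. (\<xi> (Suc n) \<omega>, W \<omega>)))"
    by (subst integral_distr) (auto simp: case_prod_beta)
  also have "\<dots> = (\<integral>p. (case p of (s, y) \<Rightarrow> \<phi> s \<bullet> y) \<partial>(M \<Otimes>\<^sub>M distr P borel W))"
    by (simp only: joint_law_sample[OF W(1)])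
  also have "\<dots> = (\<integral>y. (\<integral>s. \<phi> s \<bullet> y \<partial>M) \<partial>distr P borel W)"
    using integral_snd[OF int'] by simp
  also have "\<dots> = 0" using \<phi> by simp
  finally show "expectation (\<lambda>\<omega>. \<phi> (\<xi> (Suc n) \<omega>) \<bullet> W \<omega>) = 0" .
qed

end

section \<open>Elementary estimates\<close>

lemma power_sum_le:
  fixes x y :: real
  assumes "0 \<le> x" "0 \<le> y"
  shows "(x + y) ^ m \<le> 2 ^ m * (x ^ m + y ^ m)"
proof -
  have "(x + y) ^ m \<le> (2 * max x y) ^ m" using assms by (intro power_mono) auto
  also have "\<dots> = 2 ^ m * max x y ^ m" by (simp add: power_mult_distrib)
  also have "\<dots> \<le> 2 ^ m * (x ^ m + y ^ m)" using assms by (auto simp: max_def)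
  finally show ?thesis .
qed

text \<open>
  In the binomial expansion every term of order at least two in \<open>a\<close> carries a factor \<open>l\<^sup>2\<close>; the other
  factors \<open>l\<close> are replaced by the bound \<open>L\<close>, and the terms are summed back into a binomial.
\<close>

lemma power_add_second_order:
  fixes V a c l L :: real
  assumes "0 \<le> V" "0 \<le> l" "l \<le> L" "1 \<le> L" "0 \<le> c" and a: "\<bar>a\<bar> \<le> l * c" and p: "1 \<le> p"
  shows "(V + a) ^ p \<le> V ^ p + real p * V ^ (p - 1) * a + l\<^sup>2 * (V + L * c) ^ p"
proof -
  \<comment> \<open>The terms of order zero and one in \<open>a\<close>.\<close>
  define t where "t k = (if k = 0 then V ^ p else if k = 1 then real p * V ^ (p - 1) * a else 0)" for k :: nat
  have ak: "a ^ k \<le> l\<^sup>2 * (L * c) ^ k" if k: "2 \<le> k" for k :: nat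
  proof -
    have "a ^ k \<le> \<bar>a\<bar> ^ k" by (simp add: power_abs[symmetric])
    also have "\<dots> \<le> (l * c) ^ k" using a by (intro power_mono) auto
    also have "\<dots> = l\<^sup>2 * (l ^ (k - 2) * c ^ k)"
    proof -
      have "l ^ k = l\<^sup>2 * l ^ (k - 2)" by (metis k le_add_diff_inverse power_add)
      thus ?thesis by (simp add: power_mult_distrib)
    qed
    also have "\<dots> \<le> l\<^sup>2 * (L ^ k * c ^ k)"
    proof (intro mult_left_mono mult_right_mono)
      have "l ^ (k - 2) \<le> L ^ (k - 2)" using assms by (intro power_mono) auto
      also have "\<dots> \<le> L ^ k" using assms by (intro power_increasing) auto
      finally show "l ^ (k - 2) \<le> L ^ k" .
    qed (use assms in auto)
    finally show ?thesis by (simp add: power_mult_distrib)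
  qed
  have "(V + a) ^ p = (\<Sum>k\<le>p. real (p choose k) * a ^ k * V ^ (p - k))"
    unfolding add.commute[of V a] binomial_ring by simp
  also have "\<dots> \<le> (\<Sum>k\<le>p. t k + l\<^sup>2 * (real (p choose k) * (L * c) ^ k * V ^ (p - k)))"
  proof (rule sum_mono)
    fix k assume "k \<in> {..p}"
    have nn: "0 \<le> l\<^sup>2 * (real (p choose k) * (L * c) ^ k * V ^ (p - k))" using assms by simp
    consider "k = 0" | "k = 1" | "2 \<le> k" by linarith
    thus "real (p choose k) * a ^ k * V ^ (p - k)
        \<le> t k + l\<^sup>2 * (real (p choose k) * (L * c) ^ k * V ^ (p - k))"
    proof cases
      case 3
      have "real (p choose k) * V ^ (p - k) * a ^ k
          \<le> real (p choose k) * V ^ (p - k) * (l\<^sup>2 * (L * c) ^ k)"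
        using assms by (intro mult_left_mono ak[OF 3]) auto
      thus ?thesis using 3 by (simp add: t_def mult_ac)
    qed (use nn in \<open>simp_all add: t_def mult_ac\<close>)
  qed
  also have "\<dots> = (\<Sum>k\<le>p. t k) + l\<^sup>2 * (\<Sum>k\<le>p. real (p choose k) * (L * c) ^ k * V ^ (p - k))"
    by (simp add: sum.distrib sum_distrib_left)
  also have "(\<Sum>k\<le>p. real (p choose k) * (L * c) ^ k * V ^ (p - k)) = (V + L * c) ^ p"
    unfolding add.commute[of V "L * c"] binomial_ring by simp
  also have "(\<Sum>k\<le>p. t k) = (\<Sum>k\<in>{0, 1}. t k)"
    by (rule sum.mono_neutral_right) (use p in \<open>auto simp: t_def\<close>)
  also have "\<dots> = V ^ p + real p * V ^ (p - 1) * a" by (simp add: t_def)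
  finally show ?thesis .
qed

text \<open>
  The \<open>p\<close>-th power of the basic inequality, with \<open>v\<close> the distance to the mean zero, \<open>b\<close> the norm of
  the selection and \<open>g\<close> the cross term. The cross term is kept exactly, since only its expectation
  vanishes; the rest has to be of order \<open>l\<^sup>2\<close>.
\<close>

lemma perturbed_power_step:
  fixes v b g w l L :: real
  assumes v: "0 \<le> v" and b: "0 \<le> b" and l: "0 \<le> l" "l \<le> L" "1 \<le> L" and p: "1 \<le> p"
    and g: "\<bar>g\<bar> \<le> b * v" and w: "0 \<le> w" "w \<le> v\<^sup>2 - 2 * l * g + 2 * l\<^sup>2 * b\<^sup>2"
  shows "w ^ p \<le> v ^ (2 * p) - 2 * real p * l * ((v\<^sup>2) ^ (p - 1) * g)
    + (2 * real p + 4 ^ p * (2 * L) ^ (2 * p)) * l\<^sup>2 * (v ^ (2 * p) + b ^ (2 * p))"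
proof -
  define a where "a = 2 * l\<^sup>2 * b\<^sup>2 - 2 * l * g"
  define c where "c = 2 * b * v + 2 * L * b\<^sup>2"
  define U where "U = v ^ (2 * p) + b ^ (2 * p)"
  have "U \<ge> 0" using v b by (simp add: U_def)
  have "l * \<bar>g\<bar> \<le> l * (b * v)" using g l by (intro mult_left_mono) auto
  moreover have "l * (l * b\<^sup>2) \<le> l * (L * b\<^sup>2)" using l by (intro mult_left_mono mult_right_mono) auto
  moreover have "\<bar>a\<bar> \<le> 2 * (l * \<bar>g\<bar>) + 2 * (l * (l * b\<^sup>2))"
  proof -
    have "\<bar>2 * l\<^sup>2 * b\<^sup>2\<bar> = 2 * (l * (l * b\<^sup>2))" by (simp add: abs_mult power2_eq_square)
    moreover have "\<bar>2 * l * g\<bar> = 2 * (l * \<bar>g\<bar>)" using l by (simp add: abs_mult)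
    ultimately show ?thesis
      unfolding a_def using abs_triangle_ineq4[of "2 * l\<^sup>2 * b\<^sup>2" "2 * l * g"] by linarith
  qed
  ultimately have "\<bar>a\<bar> \<le> 2 * (l * (b * v)) + 2 * (l * (L * b\<^sup>2))" by linarith
  hence a: "\<bar>a\<bar> \<le> l * c" by (simp add: c_def algebra_simps)
  have c: "0 \<le> c" using v b l by (simp add: c_def)
  have "v\<^sup>2 + L * c \<le> (v + 2 * L * b)\<^sup>2"
    using v b l by (simp add: c_def power2_eq_square algebra_simps)
  hence "(v\<^sup>2 + L * c) ^ p \<le> ((v + 2 * L * b)\<^sup>2) ^ p" using c l by (intro power_mono) auto
  also have "\<dots> = (v + 2 * L * b) ^ (2 * p)" by (simp add: power_mult)
  also have "\<dots> \<le> 2 ^ (2 * p) * (v ^ (2 * p) + (2 * L * b) ^ (2 * p))"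
    using v b l by (intro power_sum_le) auto
  also have "\<dots> = 4 ^ p * (v ^ (2 * p) + (2 * L) ^ (2 * p) * b ^ (2 * p))"
    by (simp add: power_mult_distrib power_mult)
  also have "\<dots> \<le> 4 ^ p * ((2 * L) ^ (2 * p) * U)"
  proof (intro mult_left_mono)
    have "1 * v ^ (2 * p) \<le> (2 * L) ^ (2 * p) * v ^ (2 * p)"
      using v l by (intro mult_right_mono one_le_power) auto
    thus "v ^ (2 * p) + (2 * L) ^ (2 * p) * b ^ (2 * p) \<le> (2 * L) ^ (2 * p) * U"
      by (simp add: U_def algebra_simps)
  qed auto
  finally have rest: "l\<^sup>2 * (v\<^sup>2 + L * c) ^ p \<le> l\<^sup>2 * (4 ^ p * ((2 * L) ^ (2 * p) * U))"
    by (rule mult_left_mono) simp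
  have "(v\<^sup>2) ^ (p - 1) * b\<^sup>2 \<le> (max v b) ^ (2 * (p - 1)) * (max v b)\<^sup>2"
    unfolding power_mult using v b by (intro mult_mono power_mono) auto
  also have "\<dots> = (max v b) ^ (2 * (p - 1) + 2)" by (rule power_add[symmetric])
  also have "2 * (p - 1) + 2 = 2 * p" using p by simp
  also have "(max v b) ^ (2 * p) \<le> U" using v b by (simp add: max_def U_def)
  finally have mid: "(2 * real p * l\<^sup>2) * ((v\<^sup>2) ^ (p - 1) * b\<^sup>2) \<le> (2 * real p * l\<^sup>2) * U"
    by (rule mult_left_mono) simp
  have "w ^ p \<le> (v\<^sup>2 + a) ^ p" using w by (intro power_mono) (auto simp: a_def)
  also have "\<dots> \<le> (v\<^sup>2) ^ p + real p * (v\<^sup>2) ^ (p - 1) * a + l\<^sup>2 * (v\<^sup>2 + L * c) ^ p"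
    by (rule power_add_second_order) (use l c a p in auto)
  also have "\<dots> \<le> (v\<^sup>2) ^ p + real p * (v\<^sup>2) ^ (p - 1) * a + l\<^sup>2 * (4 ^ p * ((2 * L) ^ (2 * p) * U))"
    using rest by simp
  also have "real p * (v\<^sup>2) ^ (p - 1) * a
      = (2 * real p * l\<^sup>2) * ((v\<^sup>2) ^ (p - 1) * b\<^sup>2) - 2 * real p * l * ((v\<^sup>2) ^ (p - 1) * g)"
    by (simp add: a_def algebra_simps)
  finally have "w ^ p \<le> (v\<^sup>2) ^ p + (2 * real p * l\<^sup>2) * U - 2 * real p * l * ((v\<^sup>2) ^ (p - 1) * g)
      + l\<^sup>2 * (4 ^ p * ((2 * L) ^ (2 * p) * U))"
    using mid by linarith
  moreover have "(2 * real p + 4 ^ p * (2 * L) ^ (2 * p)) * l\<^sup>2 * U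
      = (2 * real p * l\<^sup>2) * U + l\<^sup>2 * (4 ^ p * ((2 * L) ^ (2 * p) * U))"
    by (simp add: algebra_simps)
  moreover have "v ^ (2 * p) = (v\<^sup>2) ^ p" by (rule power_mult)
  ultimately show ?thesis unfolding U_def[symmetric] by linarith
qed

text \<open>
  Adding the partial sums of \<open>d - c\<close> turns \<open>a\<close> into a decreasing sequence that is bounded below. This is
  the pathwise half of the Robbins-Siegmund theorem.
\<close>

lemma convergent_almost_decreasing:
  fixes a d c :: "nat \<Rightarrow> real"
  assumes "\<And>n. 0 \<le> a n" "\<And>n. a (Suc n) \<le> a n - d n + c n" "summable d" "summable c"
  shows "convergent a"
proof -
  define s where "s n = (\<Sum>k<n. d k - c k)" for n
  have s: "convergent s"
    using summable_diff[OF assms(3,4)] unfolding s_def summable_iff_convergent .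
  then obtain K where K: "\<And>n. \<bar>s n\<bar> \<le> K"
    using convergent_imp_Bseq[OF s] unfolding Bseq_def real_norm_def by blast
  have "decseq (\<lambda>n. a n + s n)"
    by (rule decseq_SucI) (use assms(2) in \<open>simp add: s_def algebra_simps\<close>)
  moreover have "- K \<le> a n + s n" for n using assms(1)[of n] K[of n] by linarith
  ultimately obtain u where "(\<lambda>n. a n + s n) \<longlonglongrightarrow> u" 
    using decseq_convergent[of "\<lambda>n. a n + s n" "- K"] by blast
  hence "convergent (\<lambda>n. a n + s n)" by (rule convergentI)
  from convergent_diff[OF this s] show ?thesis by simp
qed

lemma gronwall_summable:
  fixes e r :: "nat \<Rightarrow> real"
  assumes "\<And>n. 0 \<le> e n" "\<And>n. 0 \<le> r n" "summable r" "\<And>n. e (Suc n) \<le> (1 + r n) * e n"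
  shows "e n \<le> e 0 * exp (\<Sum>k. r k)"
proof -
  have "e n \<le> e 0 * exp (\<Sum>k<n. r k)"
  proof (induction n)
    case (Suc n)
    have "e (Suc n) \<le> (1 + r n) * e n" by (rule assms(4))
    also have "\<dots> \<le> exp (r n) * e n"
      by (rule mult_right_mono[OF exp_ge_add_one_self assms(1)])
    also have "\<dots> \<le> exp (r n) * (e 0 * exp (\<Sum>k<n. r k))"
      by (rule mult_left_mono[OF Suc]) simp
    finally show ?case by (simp add: exp_add mult_ac)
  qed simp
  also have "\<dots> \<le> e 0 * exp (\<Sum>k. r k)"
  proof (rule mult_left_mono[OF _ assms(1)])
    have "(\<Sum>k<n. r k) \<le> (\<Sum>k. r k)" by (rule sum_le_suminf[OF assms(3)]) (use assms(2) in auto)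
    thus "exp (\<Sum>k<n. r k) \<le> exp (\<Sum>k. r k)" by simp
  qed
  finally show ?thesis .
qed

lemma AE_summable_of_expectations:
  fixes c :: "nat \<Rightarrow> 'a \<Rightarrow> real"
  assumes int: "\<And>n. integrable M (c n)" and nn: "\<And>n x. 0 \<le> c n x"
    and sm: "summable (\<lambda>n. \<integral>x. c n x \<partial>M)"
  shows "AE x in M. summable (\<lambda>n. c n x)"
proof -
  have [measurable]: "c n \<in> borel_measurable M" for n using int by auto
  have "(\<integral>\<^sup>+x. (\<Sum>n. ennreal (c n x)) \<partial>M) = (\<Sum>n. \<integral>\<^sup>+x. ennreal (c n x) \<partial>M)"
    by (rule nn_integral_suminf) simp
  also have "\<dots> = (\<Sum>n. ennreal (\<integral>x. c n x \<partial>M))"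
    using nn_integral_eq_integral[OF int AE_I2[OF nn]] by simp
  also have "\<dots> = ennreal (\<Sum>n. \<integral>x. c n x \<partial>M)"
    by (rule suminf_ennreal2[OF integral_nonneg_AE[OF AE_I2[OF nn]] sm])
  also have "\<dots> < \<infinity>" by simp
  finally have "AE x in M. (\<Sum>n. ennreal (c n x)) \<noteq> \<infinity>"
    by (intro nn_integral_noteq_infinite) simp_all
  thus ?thesis
  proof (rule eventually_mono)
    fix x assume "(\<Sum>n. ennreal (c n x)) \<noteq> \<infinity>"
    thus "summable (\<lambda>n. c n x)" using summable_suminf_not_top[of "\<lambda>n. c n x"] nn by simp
  qed
qed

section \<open>Stochastic descent towards a mean zero\<close>

text \<open>
  The proximal iteration seen from one mean zero \<open>z\<close> with its selection \<open>\<phi>\<close>: of the resolvents only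
  the basic inequality remains.
\<close>

locale stochastic_descent = iid_recursion P M \<xi> f x0
  for P :: "'w measure" and M :: "'e measure" and \<xi>
    and f :: "nat \<Rightarrow> 'e \<Rightarrow> 'h::{real_inner, banach, second_countable_topology} \<Rightarrow> 'h" and x0 +
  fixes lam :: "nat \<Rightarrow> real" and z :: 'h and \<phi> :: "'e \<Rightarrow> 'h"
  assumes lam_nonneg: "\<And>n. 0 \<le> lam n" and lam_sq: "summable (\<lambda>n. (lam n)\<^sup>2)"
    and \<phi>_int: "integrable M \<phi>" and \<phi>_mean: "(\<integral>s. \<phi> s \<partial>M) = 0"
    and descent: "\<And>n. AE s in M. \<forall>y. (norm (f n s y - z))\<^sup>2 + (norm (y - f n s y))\<^sup>2 / 2
      \<le> (norm (y - z))\<^sup>2 - 2 * lam n * (\<phi> s \<bullet> (y - z)) + 2 * (lam n)\<^sup>2 * (norm (\<phi> s))\<^sup>2"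
begin

lemma \<phi>_measurable [measurable]: "\<phi> \<in> borel_measurable M"
  using \<phi>_int by simp

lemma sample_Suc_measurable [measurable]: "\<xi> (Suc n) \<in> measurable P M"
  by (rule sample_measurable) simp

lemma error_adapted: "(\<lambda>\<omega>. X n \<omega> - z) \<in> borel_measurable (history n)"
  using X_adapted[of n] by simp

lemma norm_error_adapted: "(\<lambda>\<omega>. norm (X n \<omega> - z)) \<in> borel_measurable (history n)"
  using measurable_compose[OF error_adapted, of norm borel n] by simp

lemma descent_path:
  "AE \<omega> in P. (norm (X (Suc n) \<omega> - z))\<^sup>2 + (norm (X n \<omega> - X (Suc n) \<omega>))\<^sup>2 / 2
    \<le> (norm (X n \<omega> - z))\<^sup>2 - 2 * lam n * (\<phi> (\<xi> (Suc n) \<omega>) \<bullet> (X n \<omega> - z))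
      + 2 * (lam n)\<^sup>2 * (norm (\<phi> (\<xi> (Suc n) \<omega>)))\<^sup>2"
  using AE_sample[OF descent[of n], of n] by (auto elim!: eventually_mono simp: X.simps)

text \<open>
  The uniform bound on the steps that serves as \<open>L\<close> in \<open>perturbed_power_step\<close>.
\<close>

lemma lam_le: "lam n \<le> 1 + (\<Sum>n. (lam n)\<^sup>2)"
proof -
  have "(lam n)\<^sup>2 \<le> (\<Sum>n. (lam n)\<^sup>2)"
    using sum_le_suminf[OF lam_sq, of "{n}"] by simp
  moreover have "2 * lam n \<le> 1 + (lam n)\<^sup>2"
    using sum_squares_bound[of "lam n" 1] by (simp add: power2_eq_square)
  ultimately show ?thesis using lam_nonneg[of n] by linarith
qed

text \<open>
  The expectation of \<open>perturbed_power_step\<close>. The cross term is the inner product of the centred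
  selection at the new sample with \<open>W\<close>, a vector determined by the past, so it disappears.
\<close>

lemma moment_step:
  assumes p: "1 \<le> p" and \<phi>_moment: "integrable M (\<lambda>s. norm (\<phi> s) ^ (2 * p))"
    and int: "integrable P (\<lambda>\<omega>. norm (X n \<omega> - z) ^ (2 * p))"
  defines "K \<equiv> 2 * real p + 4 ^ p * (2 * (1 + (\<Sum>n. (lam n)\<^sup>2))) ^ (2 * p)"
  shows "integrable P (\<lambda>\<omega>. norm (X (Suc n) \<omega> - z) ^ (2 * p))"
    and "expectation (\<lambda>\<omega>. norm (X (Suc n) \<omega> - z) ^ (2 * p))
      \<le> expectation (\<lambda>\<omega>. norm (X n \<omega> - z) ^ (2 * p))
        + K * (lam n)\<^sup>2 * (expectation (\<lambda>\<omega>. norm (X n \<omega> - z) ^ (2 * p)) + (\<integral>s. norm (\<phi> s) ^ (2 * p) \<partial>M))"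
proof -
  define W where "W \<omega> = ((norm (X n \<omega> - z))\<^sup>2) ^ (p - 1) *\<^sub>R (X n \<omega> - z)" for \<omega>
  define R where "R \<omega> = norm (X n \<omega> - z) ^ (2 * p) - 2 * real p * lam n * (\<phi> (\<xi> (Suc n) \<omega>) \<bullet> W \<omega>)
    + K * (lam n)\<^sup>2 * (norm (X n \<omega> - z) ^ (2 * p) + norm (\<phi> (\<xi> (Suc n) \<omega>)) ^ (2 * p))" for \<omega>
  have WF: "W \<in> borel_measurable (history n)"
    unfolding W_def by (intro borel_measurable_scaleR borel_measurable_power norm_error_adapted error_adapted)
  have [measurable]: "W \<in> borel_measurable P" by (rule measurable_from_subalg[OF history_subalgebra WF])
  \<comment> \<open>The norm of \<open>W\<close> is the distance to the power \<open>2 p - 1\<close>, hence integrable.\<close>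
  have W_le: "norm (W \<omega>) \<le> 1 + norm (X n \<omega> - z) ^ (2 * p)" for \<omega>
  proof -
    let ?v = "norm (X n \<omega> - z)"
    have "norm (W \<omega>) = ?v ^ (2 * p - 1)"
    proof -
      have "2 * p - 1 = Suc (2 * (p - 1))" using p by simp
      thus ?thesis by (simp only: power_Suc2 power_mult) (simp add: W_def)
    qed
    also have "\<dots> \<le> 1 + ?v ^ (2 * p)"
    proof (cases "?v \<le> 1")
      case True
      have "?v ^ (2 * p - 1) \<le> 1" using True by (intro power_le_one) auto
      thus ?thesis by (simp add: add_increasing2)
    next
      case False
      hence "?v ^ (2 * p - 1) \<le> ?v ^ (2 * p)" by (intro power_increasing) auto
      thus ?thesis by simp
    qed
    finally show ?thesis .
  qed
  have W_int: "integrable P W"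
    by (rule Bochner_Integration.integrable_bound[of _ "\<lambda>\<omega>. 1 + norm (X n \<omega> - z) ^ (2 * p)"])
       (use int W_le in simp_all)
  note cross = centred_inner_past[OF \<phi>_int \<phi>_mean WF W_int]
  have noise_int: "integrable P (\<lambda>\<omega>. norm (\<phi> (\<xi> (Suc n) \<omega>)) ^ (2 * p))"
    using integrable_sample_iff[of "\<lambda>s. norm (\<phi> s) ^ (2 * p)" n] \<phi>_moment by simp
  have noise: "expectation (\<lambda>\<omega>. norm (\<phi> (\<xi> (Suc n) \<omega>)) ^ (2 * p)) = (\<integral>s. norm (\<phi> s) ^ (2 * p) \<partial>M)"
    using integral_sample[of "\<lambda>s. norm (\<phi> s) ^ (2 * p)" n] by simp
  have R_int: "integrable P R" unfolding R_def using int cross(1) noise_int by auto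
  have step: "AE \<omega> in P. norm (X (Suc n) \<omega> - z) ^ (2 * p) \<le> R \<omega>"
    using descent_path[of n]
  proof (rule AE_mp, intro AE_I2 impI)
    fix \<omega> assume d: "(norm (X (Suc n) \<omega> - z))\<^sup>2 + (norm (X n \<omega> - X (Suc n) \<omega>))\<^sup>2 / 2
      \<le> (norm (X n \<omega> - z))\<^sup>2 - 2 * lam n * (\<phi> (\<xi> (Suc n) \<omega>) \<bullet> (X n \<omega> - z))
        + 2 * (lam n)\<^sup>2 * (norm (\<phi> (\<xi> (Suc n) \<omega>)))\<^sup>2"
    have "((norm (X (Suc n) \<omega> - z))\<^sup>2) ^ p \<le> norm (X n \<omega> - z) ^ (2 * p)
      - 2 * real p * lam n * (((norm (X n \<omega> - z))\<^sup>2) ^ (p - 1) * (\<phi> (\<xi> (Suc n) \<omega>) \<bullet> (X n \<omega> - z)))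
      + K * (lam n)\<^sup>2 * (norm (X n \<omega> - z) ^ (2 * p) + norm (\<phi> (\<xi> (Suc n) \<omega>)) ^ (2 * p))"
      unfolding K_def
    proof (rule perturbed_power_step)
      show "(norm (X (Suc n) \<omega> - z))\<^sup>2 \<le> (norm (X n \<omega> - z))\<^sup>2
          - 2 * lam n * (\<phi> (\<xi> (Suc n) \<omega>) \<bullet> (X n \<omega> - z)) + 2 * (lam n)\<^sup>2 * (norm (\<phi> (\<xi> (Suc n) \<omega>)))\<^sup>2"
        using d zero_le_power2[of "norm (X n \<omega> - X (Suc n) \<omega>)"] by linarith
      show "1 \<le> 1 + (\<Sum>n. (lam n)\<^sup>2)" using suminf_nonneg[OF lam_sq] by simp
    qed (use p lam_nonneg lam_le in \<open>auto simp: Cauchy_Schwarz_ineq2\<close>)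
    thus "norm (X (Suc n) \<omega> - z) ^ (2 * p) \<le> R \<omega>"
      by (simp add: R_def W_def power_mult)
  qed
  show *: "integrable P (\<lambda>\<omega>. norm (X (Suc n) \<omega> - z) ^ (2 * p))"
    by (rule Bochner_Integration.integrable_bound[OF R_int])
       (use step in \<open>auto elim!: eventually_mono\<close>)
  have "expectation (\<lambda>\<omega>. norm (X (Suc n) \<omega> - z) ^ (2 * p)) \<le> expectation R"
    by (rule integral_mono_AE[OF * R_int step])
  also have "expectation R = expectation (\<lambda>\<omega>. norm (X n \<omega> - z) ^ (2 * p))
        + K * (lam n)\<^sup>2 * (expectation (\<lambda>\<omega>. norm (X n \<omega> - z) ^ (2 * p)) + (\<integral>s. norm (\<phi> s) ^ (2 * p) \<partial>M))"
    unfolding R_def using int cross noise_int noise by simp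
  finally show "expectation (\<lambda>\<omega>. norm (X (Suc n) \<omega> - z) ^ (2 * p))
      \<le> expectation (\<lambda>\<omega>. norm (X n \<omega> - z) ^ (2 * p))
        + K * (lam n)\<^sup>2 * (expectation (\<lambda>\<omega>. norm (X n \<omega> - z) ^ (2 * p)) + (\<integral>s. norm (\<phi> s) ^ (2 * p) \<partial>M))" .
qed

theorem moments_bounded:
  assumes p: "1 \<le> p" and \<phi>_moment: "integrable M (\<lambda>s. norm (\<phi> s) ^ (2 * p))"
  shows "integrable P (\<lambda>\<omega>. norm (X n \<omega> - z) ^ (2 * p))"
    and "\<exists>C. \<forall>n. expectation (\<lambda>\<omega>. norm (X n \<omega> - z) ^ (2 * p)) \<le> C"
proof -
  define K where "K = 2 * real p + 4 ^ p * (2 * (1 + (\<Sum>n. (lam n)\<^sup>2))) ^ (2 * p)"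
  define e where "e n = expectation (\<lambda>\<omega>. norm (X n \<omega> - z) ^ (2 * p)) + (\<integral>s. norm (\<phi> s) ^ (2 * p) \<partial>M)" for n
  have int: "integrable P (\<lambda>\<omega>. norm (X n \<omega> - z) ^ (2 * p))" for n
    by (induction n) (auto intro: moment_step(1)[OF p \<phi>_moment] simp: X.simps(1))
  have K: "0 \<le> K" using suminf_nonneg[OF lam_sq] by (simp add: K_def)
  have "e n \<le> e 0 * exp (\<Sum>k. K * (lam k)\<^sup>2)" for n
  proof (rule gronwall_summable)
    show "0 \<le> e n" for n by (simp add: e_def)
    show "0 \<le> K * (lam n)\<^sup>2" for n using K by simp
    show "summable (\<lambda>n. K * (lam n)\<^sup>2)" by (rule summable_mult[OF lam_sq])
    show "e (Suc n) \<le> (1 + K * (lam n)\<^sup>2) * e n" for n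
      using moment_step(2)[OF p \<phi>_moment int[of n]] unfolding K_def[symmetric] e_def
      by (simp add: algebra_simps)
  qed
  moreover have "expectation (\<lambda>\<omega>. norm (X n \<omega> - z) ^ (2 * p)) \<le> e n" for n
    by (simp add: e_def)
  ultimately have "expectation (\<lambda>\<omega>. norm (X n \<omega> - z) ^ (2 * p)) \<le> e 0 * exp (\<Sum>k. K * (lam k)\<^sup>2)" for n
    by (rule order_trans[rotated])
  thus "\<exists>C. \<forall>n. expectation (\<lambda>\<omega>. norm (X n \<omega> - z) ^ (2 * p)) \<le> C" by blast
  show "integrable P (\<lambda>\<omega>. norm (X n \<omega> - z) ^ (2 * p))" by (rule int)
qed

context
  assumes \<phi>_sq: "integrable M (\<lambda>s. (norm (\<phi> s))\<^sup>2)"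
begin

lemma error_integrable:
  shows "integrable P (\<lambda>\<omega>. (norm (X n \<omega> - z))\<^sup>2)" and "integrable P (\<lambda>\<omega>. X n \<omega> - z)"
proof -
  show *: "integrable P (\<lambda>\<omega>. (norm (X n \<omega> - z))\<^sup>2)" 
  proof -
    have "integrable P (\<lambda>\<omega>. norm (X n \<omega> - z) ^ (2 * 1))"
      by (rule moments_bounded(1)) (use \<phi>_sq in simp_all)
    thus ?thesis by simp
  qed
  have "norm (X n \<omega> - z) \<le> 1 + (norm (X n \<omega> - z))\<^sup>2" for \<omega>
  proof -
    have "2 * norm (X n \<omega> - z) \<le> (norm (X n \<omega> - z))\<^sup>2 + 1"
      using sum_squares_bound[of "norm (X n \<omega> - z)" 1] by simp
    thus ?thesis using norm_ge_zero[of "X n \<omega> - z"] by linarith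
  qed
  hence le: "AE \<omega> in P. norm (X n \<omega> - z) \<le> norm (1 + (norm (X n \<omega> - z))\<^sup>2)" by simp
  have "integrable P (\<lambda>\<omega>. 1 + (norm (X n \<omega> - z))\<^sup>2)" using * by simp
  from Bochner_Integration.integrable_bound[OF this _ le]
  show "integrable P (\<lambda>\<omega>. X n \<omega> - z)" by simp
qed

lemma noise_sq:
  shows "integrable P (\<lambda>\<omega>. (norm (\<phi> (\<xi> (Suc n) \<omega>)))\<^sup>2)"
    and "expectation (\<lambda>\<omega>. (norm (\<phi> (\<xi> (Suc n) \<omega>)))\<^sup>2) = (\<integral>s. (norm (\<phi> s))\<^sup>2 \<partial>M)"
proof -
  have m: "(\<lambda>s. (norm (\<phi> s))\<^sup>2) \<in> borel_measurable M" by measurable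
  show "integrable P (\<lambda>\<omega>. (norm (\<phi> (\<xi> (Suc n) \<omega>)))\<^sup>2)"
    using \<phi>_sq unfolding integrable_sample_iff[OF m] .
  show "expectation (\<lambda>\<omega>. (norm (\<phi> (\<xi> (Suc n) \<omega>)))\<^sup>2) = (\<integral>s. (norm (\<phi> s))\<^sup>2 \<partial>M)"
    by (rule integral_sample[OF m])
qed

text \<open>
  The inner integral averages over a fresh sample; by independence it may be replaced, under the outer
  expectation, by the displacement that the actual next sample causes. The expectations of these
  displacements telescope through the basic inequality.
\<close>

theorem total_displacement_finite:
  "(\<integral>\<^sup>+\<omega>. (\<Sum>n. \<integral>\<^sup>+s. ennreal ((norm (X n \<omega> - f n s (X n \<omega>)))\<^sup>2) \<partial>M) \<partial>P) < \<infinity>"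
proof -
  define e where "e n = expectation (\<lambda>\<omega>. (norm (X n \<omega> - z))\<^sup>2)" for n
  define \<beta> where "\<beta> = (\<integral>s. (norm (\<phi> s))\<^sup>2 \<partial>M)"
  define Q where "Q n \<omega> = (norm (X n \<omega> - X (Suc n) \<omega>))\<^sup>2" for n \<omega>
  \<comment> \<open>The basic inequality says that \<open>Q n\<close> is at most \<open>2 * R n\<close>.\<close>
  define R where "R n \<omega> = (norm (X n \<omega> - z))\<^sup>2 - 2 * lam n * (\<phi> (\<xi> (Suc n) \<omega>) \<bullet> (X n \<omega> - z))
      + 2 * (lam n)\<^sup>2 * (norm (\<phi> (\<xi> (Suc n) \<omega>)))\<^sup>2 - (norm (X (Suc n) \<omega> - z))\<^sup>2" for n \<omega>
  have [measurable]: "Q n \<in> borel_measurable P" for n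
    unfolding Q_def using X_measurable[of n] X_measurable[of "Suc n"] by simp
  note cross = centred_inner_past[OF \<phi>_int \<phi>_mean error_adapted error_integrable(2)]
  have R_int: "integrable P (R n)" for n
    unfolding R_def using error_integrable(1) cross(1) noise_sq(1) by simp
  have R_exp: "expectation (R n) = e n - e (Suc n) + 2 * (lam n)\<^sup>2 * \<beta>" for n
    unfolding R_def e_def \<beta>_def
    using error_integrable(1) cross noise_sq by simp
  have QR: "AE \<omega> in P. Q n \<omega> \<le> 2 * R n \<omega>" for n
    using descent_path[of n]
    by (rule AE_mp) (auto intro!: AE_I2 simp: Q_def R_def algebra_simps)
  have Q_int: "integrable P (Q n)" for n
    by (rule Bochner_Integration.integrable_bound[of _ "\<lambda>\<omega>. 2 * R n \<omega>"])
       (use R_int QR[of n] in \<open>auto elim!: eventually_mono simp: Q_def\<close>)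
  have Q_exp: "expectation (Q n) \<le> 2 * (e n - e (Suc n)) + 4 * (lam n)\<^sup>2 * \<beta>" for n
    using integral_mono_AE[OF Q_int integrable_mult_right[OF R_int] QR, of n] R_exp[of n] by simp
  have "summable (\<lambda>n. expectation (Q n))"
  proof (rule summableI_nonneg_bounded)
    show "0 \<le> expectation (Q n)" for n by (simp add: Q_def)
    fix n
    have "(\<Sum>k<n. expectation (Q k)) \<le> (\<Sum>k<n. 2 * (e k - e (Suc k)) + 4 * (lam k)\<^sup>2 * \<beta>)"
      by (rule sum_mono[OF Q_exp])
    also have "\<dots> = 2 * (e 0 - e n) + 4 * \<beta> * (\<Sum>k<n. (lam k)\<^sup>2)"
      by (induction n) (simp_all add: algebra_simps)
    also have "\<dots> \<le> 2 * e 0 + 4 * \<beta> * (\<Sum>k. (lam k)\<^sup>2)"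
    proof (rule add_mono)
      show "2 * (e 0 - e n) \<le> 2 * e 0" by (simp add: e_def)
      show "4 * \<beta> * (\<Sum>k<n. (lam k)\<^sup>2) \<le> 4 * \<beta> * (\<Sum>k. (lam k)\<^sup>2)"
        using sum_le_suminf[OF lam_sq] by (intro mult_left_mono) (auto simp: \<beta>_def)
    qed
    finally show "(\<Sum>k<n. expectation (Q k)) \<le> 2 * e 0 + 4 * \<beta> * (\<Sum>k. (lam k)\<^sup>2)" .
  qed
  hence fin: "(\<Sum>n. ennreal (expectation (Q n))) < \<infinity>"
    by (subst suminf_ennreal2) (auto simp: Q_def)
  note f_measurable [measurable]
  have h [measurable]: "(\<lambda>p. ennreal ((norm (snd p - f n (fst p) (snd p)))\<^sup>2)) \<in> borel_measurable (M \<Otimes>\<^sub>M borel)" for n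
    using f_measurable[of n] by (simp add: case_prod_beta)
  have h' [measurable]: "(\<lambda>y. \<integral>\<^sup>+s. ennreal ((norm (y - f n s y))\<^sup>2) \<partial>M) \<in> borel_measurable borel" for n
    using samples.borel_measurable_nn_integral_fst
      [of "\<lambda>(y, s). ennreal ((norm (y - f n s y))\<^sup>2)" borel]
      measurable_compose[OF measurable_pair_swap' h[of n]]
    by (simp add: case_prod_beta)
  have "(\<integral>\<^sup>+\<omega>. (\<Sum>n. \<integral>\<^sup>+s. ennreal ((norm (X n \<omega> - f n s (X n \<omega>)))\<^sup>2) \<partial>M) \<partial>P)
      = (\<Sum>n. \<integral>\<^sup>+\<omega>. (\<integral>\<^sup>+s. ennreal ((norm (X n \<omega> - f n s (X n \<omega>)))\<^sup>2) \<partial>M) \<partial>P)"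
    by (rule nn_integral_suminf) (rule measurable_compose[OF X_measurable h'])
  also have "\<dots> = (\<Sum>n. \<integral>\<^sup>+\<omega>. ennreal (Q n \<omega>) \<partial>P)"
  proof (rule suminf_cong)
    fix n
    show "(\<integral>\<^sup>+\<omega>. (\<integral>\<^sup>+s. ennreal ((norm (X n \<omega> - f n s (X n \<omega>)))\<^sup>2) \<partial>M) \<partial>P) = (\<integral>\<^sup>+\<omega>. ennreal (Q n \<omega>) \<partial>P)"
      using nn_integral_next_sample[OF X_adapted[of n] h[of n]] by (simp add: Q_def X.simps(2))
  qed
  also have "\<dots> = (\<Sum>n. ennreal (expectation (Q n)))"
    by (intro suminf_cong nn_integral_eq_integral Q_int) (auto simp: Q_def)
  finally show ?thesis using fin by simp
qed

text \<open>
  The cross terms \<open>d\<close> have variances of order \<open>(lam n)\<^sup>2\<close>, since the second moments of the distances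
  are bounded, so their series converges almost surely; so does the series of the error terms \<open>c\<close>.
\<close>

theorem AE_convergent_distance: "AE \<omega> in P. convergent (\<lambda>n. norm (X n \<omega> - z))"
proof -
  define d where "d n \<omega> = 2 * lam n * (\<phi> (\<xi> (Suc n) \<omega>) \<bullet> (X n \<omega> - z))" for n \<omega>
  define c where "c n \<omega> = 2 * (lam n)\<^sup>2 * (norm (\<phi> (\<xi> (Suc n) \<omega>)))\<^sup>2" for n \<omega>
  define \<beta> where "\<beta> = (\<integral>s. (norm (\<phi> s))\<^sup>2 \<partial>M)"
  obtain C where C: "\<And>n. expectation (\<lambda>\<omega>. (norm (X n \<omega> - z))\<^sup>2) \<le> C"
  proof -
    have "\<exists>C. \<forall>n. expectation (\<lambda>\<omega>. norm (X n \<omega> - z) ^ (2 * 1)) \<le> C"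
      by (rule moments_bounded(2)) (use \<phi>_sq in simp_all)
    thus thesis using that unfolding mult_1_right by blast
  qed
  have d_adapted: "d n \<in> borel_measurable (history (Suc n))" for n
  proof -
    have "(\<lambda>\<omega>. X n \<omega> - z) \<in> borel_measurable (history (Suc n))"
      by (rule measurable_history_mono[OF _ error_adapted]) simp
    moreover have "(\<lambda>\<omega>. \<phi> (\<xi> (Suc n) \<omega>)) \<in> borel_measurable (history (Suc n))"
      by (rule measurable_compose[OF sample_history \<phi>_measurable]) auto
    ultimately show ?thesis unfolding d_def by simp
  qed
  have [measurable]: "d n \<in> borel_measurable P" for n
    by (rule measurable_from_subalg[OF history_subalgebra d_adapted])
  have V_meas: "(\<lambda>\<omega>. (norm (X n \<omega> - z))\<^sup>2) \<in> borel_measurable (history n)" for n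
    by (intro borel_measurable_power norm_error_adapted)
  note prod = indep_product[OF \<phi>_sq V_meas error_integrable(1)]
  have d_le: "(d n \<omega>)\<^sup>2 \<le> 4 * (lam n)\<^sup>2 * ((norm (\<phi> (\<xi> (Suc n) \<omega>)))\<^sup>2 * (norm (X n \<omega> - z))\<^sup>2)" for n \<omega>
  proof -
    have "(\<phi> (\<xi> (Suc n) \<omega>) \<bullet> (X n \<omega> - z))\<^sup>2 \<le> (norm (\<phi> (\<xi> (Suc n) \<omega>)) * norm (X n \<omega> - z))\<^sup>2"
      by (rule power2_le_iff_abs_le[THEN iffD2]) (simp_all add: Cauchy_Schwarz_ineq2)
    thus ?thesis by (simp add: d_def power_mult_distrib mult_left_mono)
  qed
  have d_int: "integrable P (\<lambda>\<omega>. (d n \<omega>)\<^sup>2)" for n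
    by (rule Bochner_Integration.integrable_bound[OF integrable_mult_right[OF prod(1), of "4 * (lam n)\<^sup>2" n]])
       (use d_le in auto)
  have d_exp: "expectation (\<lambda>\<omega>. (d n \<omega>)\<^sup>2) \<le> 4 * \<beta> * C * (lam n)\<^sup>2" for n
  proof -
    have "expectation (\<lambda>\<omega>. (d n \<omega>)\<^sup>2) \<le> 4 * (lam n)\<^sup>2 * (\<beta> * expectation (\<lambda>\<omega>. (norm (X n \<omega> - z))\<^sup>2))"
      using integral_mono[OF d_int integrable_mult_right[OF prod(1)] d_le] prod(2)
      by (simp add: \<beta>_def)
    also have "\<dots> \<le> 4 * (lam n)\<^sup>2 * (\<beta> * C)"
      using C by (intro mult_left_mono) (auto simp: \<beta>_def)
    finally show ?thesis by (simp add: mult_ac)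
  qed
  interpret L2_martingale_differences P history d
  proof unfold_locales
    fix k and g :: "'w \<Rightarrow> real"
    assume g: "g \<in> borel_measurable (history k)" "integrable P (\<lambda>\<omega>. (g \<omega>)\<^sup>2)"
    have [measurable]: "g \<in> borel_measurable P" by (rule measurable_from_subalg[OF history_subalgebra g(1)])
    let ?W = "\<lambda>\<omega>. g \<omega> *\<^sub>R (X k \<omega> - z)"
    have le: "norm (?W \<omega>) \<le> norm ((g \<omega>)\<^sup>2 + (norm (X k \<omega> - z))\<^sup>2)" for \<omega>
    proof -
      have "2 * (\<bar>g \<omega>\<bar> * norm (X k \<omega> - z)) \<le> (g \<omega>)\<^sup>2 + (norm (X k \<omega> - z))\<^sup>2"
        using sum_squares_bound[of "\<bar>g \<omega>\<bar>" "norm (X k \<omega> - z)"] by simp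
      moreover have "0 \<le> \<bar>g \<omega>\<bar> * norm (X k \<omega> - z)" by simp
      ultimately have "\<bar>g \<omega>\<bar> * norm (X k \<omega> - z) \<le> (g \<omega>)\<^sup>2 + (norm (X k \<omega> - z))\<^sup>2"
        by linarith
      thus ?thesis by simp
    qed
    have "integrable P (\<lambda>\<omega>. (g \<omega>)\<^sup>2 + (norm (X k \<omega> - z))\<^sup>2)"
      using g(2) error_integrable(1) by (rule Bochner_Integration.integrable_add)
    from Bochner_Integration.integrable_bound[OF this _ AE_I2[OF le]]
    have "integrable P ?W" by simp
    moreover have "?W \<in> borel_measurable (history k)"
      using g(1) error_adapted by (intro borel_measurable_scaleR)
    ultimately have "expectation (\<lambda>\<omega>. \<phi> (\<xi> (Suc k) \<omega>) \<bullet> ?W \<omega>) = 0"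
      by (intro centred_inner_past(2)[OF \<phi>_int \<phi>_mean])
    hence "expectation (\<lambda>\<omega>. 2 * lam k * (\<phi> (\<xi> (Suc k) \<omega>) \<bullet> ?W \<omega>)) = 0" by simp
    thus "expectation (\<lambda>\<omega>. d k \<omega> * g \<omega>) = 0" by (simp add: d_def mult_ac)
  qed (use history_subalgebra history_mono d_adapted d_int in auto)
  have "summable (\<lambda>n. expectation (\<lambda>\<omega>. (d n \<omega>)\<^sup>2))"
    by (rule summable_comparison_test'[OF summable_mult[OF lam_sq, of "4 * \<beta> * C"], of 0])
       (use d_exp in auto)
  from AE_summable[OF this] have d_sm: "AE \<omega> in P. summable (\<lambda>n. d n \<omega>)" .
  have c_sm: "AE \<omega> in P. summable (\<lambda>n. c n \<omega>)"
  proof (rule AE_summable_of_expectations)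
    show "integrable P (c n)" for n unfolding c_def using noise_sq(1) by simp
    have "expectation (c n) = 2 * \<beta> * (lam n)\<^sup>2" for n
      unfolding c_def using noise_sq by (simp add: \<beta>_def)
    thus "summable (\<lambda>n. expectation (c n))" using summable_mult[OF lam_sq, of "2 * \<beta>"] by simp
  qed (simp add: c_def)
  have "AE \<omega> in P. \<forall>n. (norm (X (Suc n) \<omega> - z))\<^sup>2 \<le> (norm (X n \<omega> - z))\<^sup>2 - d n \<omega> + c n \<omega>"
    unfolding AE_all_countable
  proof
    fix n show "AE \<omega> in P. (norm (X (Suc n) \<omega> - z))\<^sup>2 \<le> (norm (X n \<omega> - z))\<^sup>2 - d n \<omega> + c n \<omega>"
      using descent_path[of n]
    proof (rule AE_mp, intro AE_I2 impI)
      fix \<omega> assume "(norm (X (Suc n) \<omega> - z))\<^sup>2 + (norm (X n \<omega> - X (Suc n) \<omega>))\<^sup>2 / 2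
        \<le> (norm (X n \<omega> - z))\<^sup>2 - 2 * lam n * (\<phi> (\<xi> (Suc n) \<omega>) \<bullet> (X n \<omega> - z))
          + 2 * (lam n)\<^sup>2 * (norm (\<phi> (\<xi> (Suc n) \<omega>)))\<^sup>2"
      thus "(norm (X (Suc n) \<omega> - z))\<^sup>2 \<le> (norm (X n \<omega> - z))\<^sup>2 - d n \<omega> + c n \<omega>"
        unfolding d_def c_def using zero_le_power2[of "norm (X n \<omega> - X (Suc n) \<omega>)"] by linarith
    qed
  qed
  with d_sm c_sm show ?thesis
  proof eventually_elim
    case (elim \<omega>)
    hence "convergent (\<lambda>n. (norm (X n \<omega> - z))\<^sup>2)"
      by (intro convergent_almost_decreasing[of _ "\<lambda>n. d n \<omega>" "\<lambda>n. c n \<omega>"]) (auto)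
    then obtain a where "(\<lambda>n. (norm (X n \<omega> - z))\<^sup>2) \<longlonglongrightarrow> a" by (auto simp: convergent_def)
    from tendsto_real_sqrt[OF this] show ?case by (auto simp: convergent_def)
  qed
qed

end

end

section \<open>The stochastic proximal point iteration\<close>

lemma norm_yosida: "norm (yosida l T x) = norm (x - resolvent l T x) / \<bar>l\<bar>"
  by (simp add: yosida_def divide_inverse mult.commute)

lemma continuous_on_resolvent:
  fixes T :: "'h::{real_inner, complete_space} \<Rightarrow> 'h set"
  assumes "maximal_monotone T" "0 < l"
  shows "continuous_on UNIV (resolvent l T)"
proof -
  have "1-lipschitz_on UNIV (resolvent l T)"
    using resolvent_nonexpansive[OF assms] by (auto intro!: lipschitz_onI simp: dist_norm)
  thus ?thesis by (rule lipschitz_on_continuous_on)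
qed

lemma Lp_selections_integrable:
  assumes M: "prob_space M" and k: "1 \<le> k" and sel: "\<phi> \<in> Lp_selections M A (real k) y"
  shows "integrable M (\<lambda>s. norm (\<phi> s) ^ k)" and "integrable M \<phi>"
proof -
  interpret prob_space M by fact
  have [measurable]: "\<phi> \<in> borel_measurable M" using sel by (simp add: Lp_selections_def)
  have "norm (\<phi> s) powr real k = norm (\<phi> s) ^ k" for s
    using k by (intro powr_realpow') auto
  hence "(\<integral>\<^sup>+ s. ennreal (norm (\<phi> s) ^ k) \<partial>M) < \<infinity>" using sel by (simp add: Lp_selections_def)
  thus *: "integrable M (\<lambda>s. norm (\<phi> s) ^ k)" by (intro integrableI_bounded) simp_all
  have le: "norm (\<phi> s) \<le> norm (1 + norm (\<phi> s) ^ k)" for s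
  proof (cases "norm (\<phi> s) \<le> 1")
    case True
    thus ?thesis by (simp add: add_increasing2)
  next
    case False
    hence "norm (\<phi> s) ^ 1 \<le> norm (\<phi> s) ^ k" using k by (intro power_increasing) auto
    thus ?thesis by simp
  qed
  have "integrable M (\<lambda>s. 1 + norm (\<phi> s) ^ k)" using * by simp
  from Bochner_Integration.integrable_bound[OF this _ AE_I2[OF le]]
  show "integrable M \<phi>" by simp
qed

text \<open>
  Distances to nearby points differ uniformly in \<open>n\<close> by at most the distance of the points.
\<close>

lemma convergent_dist_closure:
  fixes x :: "nat \<Rightarrow> 'h::real_normed_vector"
  assumes conv: "\<And>d. d \<in> D \<Longrightarrow> convergent (\<lambda>n. norm (x n - d))" and z: "z \<in> closure D"
  shows "convergent (\<lambda>n. norm (x n - z))"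
proof -
  have "Cauchy (\<lambda>n. norm (x n - z))"
  proof (rule metric_CauchyI)
    fix e :: real assume e: "0 < e"
    with z obtain d where d: "d \<in> D" "dist d z < e / 3"
      unfolding closure_approachable by (meson zero_less_divide_iff zero_less_numeral)
    have near: "\<bar>norm (x n - z) - norm (x n - d)\<bar> < e / 3" for n
      using norm_triangle_ineq3[of "x n - z" "x n - d"] d(2) by (simp add: dist_norm)
    have "Cauchy (\<lambda>n. norm (x n - d))" using conv[OF d(1)] by (rule convergent_Cauchy)
    then obtain K where K: "\<And>m n. K \<le> m \<Longrightarrow> K \<le> n \<Longrightarrow> \<bar>norm (x m - d) - norm (x n - d)\<bar> < e / 3"
      using e unfolding Cauchy_def dist_real_def by (meson zero_less_divide_iff zero_less_numeral)
    have "dist (norm (x m - z)) (norm (x n - z)) < e" if "K \<le> m" "K \<le> n" for m n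
      using near[of m] near[of n] K[OF that] unfolding dist_real_def by linarith
    thus "\<exists>K. \<forall>m\<ge>K. \<forall>n\<ge>K. dist (norm (x m - z)) (norm (x n - z)) < e" by blast
  qed
  thus ?thesis by (simp add: Cauchy_convergent_iff)
qed

theorem proposition1:
  fixes M :: "'e measure"
    and P :: "'w measure"
    and A :: "'e \<Rightarrow> 'h::{real_inner, banach, second_countable_topology} \<Rightarrow> 'h set"
    and \<xi> :: "nat \<Rightarrow> 'w \<Rightarrow> 'e"
    and lam :: "nat \<Rightarrow> real"
    and x\<^sub>0 :: 'h
    and x :: "nat \<Rightarrow> 'w \<Rightarrow> 'h"
  assumes "prob_space M" and "complete_measure M"
    and "prob_space P"
    and "AE s in M. maximal_monotone (A s)"
    and "\<And>l y. 0 < l \<Longrightarrow> (\<lambda>s. resolvent l (A s) y) \<in> borel_measurable M"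
    and "\<And>n. 0 < lam n"
    and "(\<Sum>n. ennreal (lam n)) = \<infinity>"
    and "summable (\<lambda>n. (lam n)\<^sup>2)"
    and "prob_space.indep_vars P (\<lambda>_. M) \<xi> {1..}"
    and "\<And>n. 1 \<le> n \<Longrightarrow> distr P M (\<xi> n) = M"
    and "mean_zeros M A 2 \<noteq> {}"
    and "\<And>\<omega>. \<omega> \<in> space P \<Longrightarrow> x 0 \<omega> = x\<^sub>0"
    and "\<And>n \<omega>. \<omega> \<in> space P \<Longrightarrow>
           x (n + 1) \<omega> = resolvent (lam n) (A (\<xi> (n + 1) \<omega>)) (x n \<omega>)"
  shows "(\<exists>B\<in>sets P. measure P B = 1 \<and>
            (\<forall>\<omega>\<in>B. \<forall>z\<in>mean_zeros M A 2. convergent (\<lambda>n. norm (x n \<omega> - z))))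
       \<and> (\<integral>\<^sup>+ \<omega>. (\<Sum>n. ennreal ((lam n)\<^sup>2) *
              (\<integral>\<^sup>+ s. ennreal ((norm (yosida (lam n) (A s) (x n \<omega>)))\<^sup>2) \<partial>M)) \<partial>P) < \<infinity>
       \<and> (\<forall>p::nat. 1 \<le> p \<and> mean_zeros M A (2 * real p) \<noteq> {} \<longrightarrow>
            (SUP n. \<integral>\<^sup>+ \<omega>. ennreal (norm (x n \<omega>) ^ (2 * p)) \<partial>P) < \<infinity>)"
proof -
  note lam_pos = assms(6)
  interpret M: prob_space M by fact
  interpret P: prob_space P by fact
  obtain N where mm: "\<And>s. s \<in> space M - N \<Longrightarrow> maximal_monotone (A s)" and N: "N \<in> null_sets M"
    using AE_E3[OF assms(4)] by blast
  have N_sets [measurable]: "N \<in> sets M" using N by auto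
  have AE_N: "AE s in M. s \<in> space M - N" using AE_not_in[OF N] AE_space by eventually_elim auto
  \<comment> \<open>On the null set where maximality may fail the step is the identity, which makes the map jointly
    measurable and leaves the iteration almost surely unchanged.\<close>
  define f where "f n s y = (if s \<in> N then y else resolvent (lam n) (A s) y)" for n s y
  have f_meas: "(\<lambda>(s, y). f n s y) \<in> borel_measurable (M \<Otimes>\<^sub>M borel)" for n
  proof (rule borel_measurable_Caratheodory)
    fix y
    have [measurable]: "(\<lambda>s. resolvent (lam n) (A s) y) \<in> borel_measurable M"
      by (rule assms(5)[OF lam_pos])
    show "(\<lambda>s. f n s y) \<in> borel_measurable M" unfolding f_def by measurable
  next
    fix s assume "s \<in> space M"
    thus "continuous_on UNIV (f n s)"
      using continuous_on_resolvent[OF mm lam_pos, of s n]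
      by (cases "s \<in> N") (simp_all add: f_def[abs_def])
  qed
  interpret R: iid_recursion P M \<xi> f x\<^sub>0
    by unfold_locales (use assms(9,10) f_meas in auto)
  \<comment> \<open>The iterates themselves need not be measurable, since the null set may be hit; they agree almost
    surely with the measurable iteration.\<close>
  have same: "AE \<omega> in P. \<forall>n. x n \<omega> = R.X n \<omega>"
  proof -
    have "AE \<omega> in P. \<forall>n. \<xi> (Suc n) \<omega> \<in> space M - N"
      unfolding AE_all_countable using R.AE_sample[OF AE_N] by blast
    with AE_space show ?thesis
    proof eventually_elim
      case (elim \<omega>)
      have step: "x (Suc n) \<omega> = f n (\<xi> (Suc n) \<omega>) (x n \<omega>)" for n
        using elim assms(13)[of \<omega> n] by (simp add: f_def)
      have "x n \<omega> = R.X n \<omega>" for n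
        by (induction n) (simp_all add: R.X.simps step assms(12)[OF elim(1)])
      thus ?case by blast
    qed
  qed
  have descent: "stochastic_descent P M \<xi> f lam z \<phi>"
    if \<phi>: "\<phi> \<in> Lp_selections M A (real (2 * p)) z" "(\<integral>s. \<phi> s \<partial>M) = 0" and p: "1 \<le> p" for z \<phi> and p :: nat
  proof unfold_locales
    show "integrable M \<phi>"
      using Lp_selections_integrable(2)[OF assms(1) _ \<phi>(1)] p by simp
    show "AE s in M. \<forall>y. (norm (f n s y - z))\<^sup>2 + (norm (y - f n s y))\<^sup>2 / 2
      \<le> (norm (y - z))\<^sup>2 - 2 * lam n * (\<phi> s \<bullet> (y - z)) + 2 * (lam n)\<^sup>2 * (norm (\<phi> s))\<^sup>2" for n
    proof -
      have "AE s in M. \<phi> s \<in> A s z" using \<phi>(1) by (simp add: Lp_selections_def)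
      with AE_N show ?thesis
      proof eventually_elim
        case (elim s)
        thus ?case using resolvent_energy_decrease[OF mm lam_pos, of s "\<phi> s" z n] by (simp add: f_def)
      qed
    qed
  qed (use lam_pos assms(8) \<phi>(2) in \<open>auto intro: less_imp_le\<close>)
  have zero: "\<exists>\<phi>. stochastic_descent P M \<xi> f lam z \<phi> \<and> integrable M (\<lambda>s. norm (\<phi> s) ^ (2 * p))"
    if z: "z \<in> mean_zeros M A (2 * real p)" and p: "1 \<le> p" for z and p :: nat
  proof -
    obtain \<phi> where \<phi>: "\<phi> \<in> Lp_selections M A (real (2 * p)) z" "(\<integral>s. \<phi> s \<partial>M) = 0"
      using z by (auto simp: mean_zeros_def)
    show ?thesis
      using descent[OF \<phi> p] Lp_selections_integrable(1)[OF assms(1) _ \<phi>(1)] p by (intro exI[of _ \<phi>]) simp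
  qed
  have zero2: "\<exists>\<phi>. stochastic_descent P M \<xi> f lam z \<phi> \<and> integrable M (\<lambda>s. (norm (\<phi> s))\<^sup>2)"
    if "z \<in> mean_zeros M A 2" for z
    using zero[of z 1] that by simp

  have i: "\<exists>B\<in>sets P. measure P B = 1 \<and>
      (\<forall>\<omega>\<in>B. \<forall>z\<in>mean_zeros M A 2. convergent (\<lambda>n. norm (x n \<omega> - z)))"
  proof -
    \<comment> \<open>Convergence at the members of a countable dense set of mean zeros has a common null set.\<close>
    obtain D where D: "countable D" "D \<subseteq> mean_zeros M A 2" "mean_zeros M A 2 \<subseteq> closure D"
      using separable by blast
    have "AE \<omega> in P. \<forall>z\<in>D. convergent (\<lambda>n. norm (R.X n \<omega> - z))"
    proof (subst AE_ball_countable[OF D(1)], intro ballI)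
      fix z assume "z \<in> D"
      hence "z \<in> mean_zeros M A 2" using D(2) by (rule subsetD[rotated])
      from zero2[OF this] obtain \<phi> where \<phi>: "stochastic_descent P M \<xi> f lam z \<phi>"
        "integrable M (\<lambda>s. (norm (\<phi> s))\<^sup>2)" by (elim exE conjE)
      show "AE \<omega> in P. convergent (\<lambda>n. norm (R.X n \<omega> - z))"
        by (rule stochastic_descent.AE_convergent_distance[OF \<phi>])
    qed
    with same have "AE \<omega> in P. \<forall>z\<in>mean_zeros M A 2. convergent (\<lambda>n. norm (x n \<omega> - z))"
    proof eventually_elim
      case (elim \<omega>)
      show ?case
      proof
        fix z assume "z \<in> mean_zeros M A 2"
        hence "z \<in> closure D" using D(3) by (rule subsetD[rotated])
        from convergent_dist_closure[OF bspec[OF elim(2)] this]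
        have "convergent (\<lambda>n. norm (R.X n \<omega> - z))" .
        thus "convergent (\<lambda>n. norm (x n \<omega> - z))" using elim(1) by simp
      qed
    qed
    then obtain B
      where B: "B \<subseteq> {\<omega>\<in>space P. \<forall>z\<in>mean_zeros M A 2. convergent (\<lambda>n. norm (x n \<omega> - z))}"
        "B \<in> sets P" "measure P B = 1"
      by (rule P.AE_E_prob)
    have "\<forall>\<omega>\<in>B. \<forall>z\<in>mean_zeros M A 2. convergent (\<lambda>n. norm (x n \<omega> - z))"
      using B(1) by (simp add: subset_eq)
    with B(2,3) show ?thesis by (intro bexI[of _ B] conjI)
  qed

  have ii: "(\<integral>\<^sup>+ \<omega>. (\<Sum>n. ennreal ((lam n)\<^sup>2) *
      (\<integral>\<^sup>+ s. ennreal ((norm (yosida (lam n) (A s) (x n \<omega>)))\<^sup>2) \<partial>M)) \<partial>P) < \<infinity>"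
  proof -
    have scale: "ennreal ((lam n)\<^sup>2) * (\<integral>\<^sup>+ s. ennreal ((norm (yosida (lam n) (A s) y))\<^sup>2) \<partial>M)
        = (\<integral>\<^sup>+ s. ennreal ((norm (y - f n s y))\<^sup>2) \<partial>M)" for n y
    proof -
      have [measurable]: "(\<lambda>s. resolvent (lam n) (A s) y) \<in> borel_measurable M"
        by (rule assms(5)[OF lam_pos])
      have "ennreal ((lam n)\<^sup>2) * (\<integral>\<^sup>+ s. ennreal ((norm (yosida (lam n) (A s) y))\<^sup>2) \<partial>M)
          = (\<integral>\<^sup>+ s. ennreal ((lam n)\<^sup>2) * ennreal ((norm (yosida (lam n) (A s) y))\<^sup>2) \<partial>M)"
        by (rule nn_integral_cmult[symmetric]) (simp add: yosida_def)
      also have "\<dots> = (\<integral>\<^sup>+ s. ennreal ((norm (y - f n s y))\<^sup>2) \<partial>M)"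
      proof (rule nn_integral_cong_AE, use AE_N in eventually_elim)
        case (elim s)
        thus ?case using lam_pos[of n]
          by (simp add: f_def norm_yosida power_divide flip: ennreal_mult)
      qed
      finally show ?thesis .
    qed
    have "(\<integral>\<^sup>+ \<omega>. (\<Sum>n. ennreal ((lam n)\<^sup>2) *
        (\<integral>\<^sup>+ s. ennreal ((norm (yosida (lam n) (A s) (x n \<omega>)))\<^sup>2) \<partial>M)) \<partial>P)
      = (\<integral>\<^sup>+ \<omega>. (\<Sum>n. \<integral>\<^sup>+ s. ennreal ((norm (R.X n \<omega> - f n s (R.X n \<omega>)))\<^sup>2) \<partial>M) \<partial>P)"
      unfolding scale by (rule nn_integral_cong_AE, use same in eventually_elim) simp
    moreover from assms(11) obtain z where "z \<in> mean_zeros M A 2" by blast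
    from zero2[OF this] obtain \<phi> where \<phi>: "stochastic_descent P M \<xi> f lam z \<phi>"
      "integrable M (\<lambda>s. (norm (\<phi> s))\<^sup>2)" by (elim exE conjE)
    ultimately show ?thesis using stochastic_descent.total_displacement_finite[OF \<phi>] by simp
  qed

  have iii: "(SUP n. \<integral>\<^sup>+ \<omega>. ennreal (norm (x n \<omega>) ^ (2 * p)) \<partial>P) < \<infinity>"
    if p: "1 \<le> p" "mean_zeros M A (2 * real p) \<noteq> {}" for p :: nat
  proof -
    from p(2) obtain z where "z \<in> mean_zeros M A (2 * real p)" by blast
    from zero[OF this p(1)] obtain \<phi> where \<phi>: "stochastic_descent P M \<xi> f lam z \<phi>"
      "integrable M (\<lambda>s. norm (\<phi> s) ^ (2 * p))" by (elim exE conjE)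
    note mom = stochastic_descent.moments_bounded[OF \<phi>(1) p(1) \<phi>(2)]
    obtain C where C: "\<And>n. P.expectation (\<lambda>\<omega>. norm (R.X n \<omega> - z) ^ (2 * p)) \<le> C"
      using mom(2) by blast
    let ?K = "2 ^ (2 * p) * (C + norm z ^ (2 * p))"
    have "(\<integral>\<^sup>+ \<omega>. ennreal (norm (x n \<omega>) ^ (2 * p)) \<partial>P) \<le> ennreal ?K" for n
    proof -
      let ?r = "\<lambda>\<omega>. 2 ^ (2 * p) * (norm (R.X n \<omega> - z) ^ (2 * p) + norm z ^ (2 * p))"
      have "(\<integral>\<^sup>+ \<omega>. ennreal (norm (x n \<omega>) ^ (2 * p)) \<partial>P) \<le> (\<integral>\<^sup>+ \<omega>. ennreal (?r \<omega>) \<partial>P)"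
      proof (rule nn_integral_mono_AE, use same in eventually_elim)
        case (elim \<omega>)
        have "norm (R.X n \<omega>) ^ (2 * p) \<le> (norm (R.X n \<omega> - z) + norm z) ^ (2 * p)"
          using norm_triangle_ineq[of "R.X n \<omega> - z" z] by (intro power_mono) simp_all
        also have "\<dots> \<le> ?r \<omega>" by (rule power_sum_le) simp_all
        finally show ?case using elim by (intro ennreal_leI) simp
      qed
      also have "\<dots> = ennreal (P.expectation ?r)"
        by (rule nn_integral_eq_integral) (use mom(1)[of x\<^sub>0 n] in simp_all)
      also have "P.expectation ?r = 2 ^ (2 * p) * (P.expectation (\<lambda>\<omega>. norm (R.X n \<omega> - z) ^ (2 * p)) + norm z ^ (2 * p))"
        using mom(1)[of x\<^sub>0 n] by (simp add: P.prob_space)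
      also have "ennreal \<dots> \<le> ennreal ?K"
        by (intro ennreal_leI mult_left_mono add_right_mono C) simp
      finally show ?thesis .
    qed
    hence "(SUP n. \<integral>\<^sup>+ \<omega>. ennreal (norm (x n \<omega>) ^ (2 * p)) \<partial>P) \<le> ennreal ?K"
      by (rule SUP_least)
    thus ?thesis by (rule le_less_trans) simp
  qed
  show ?thesis using i ii iii by (intro conjI allI impI) simp_all
qed

end
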